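(* Let $q\geq 3$ be odd. For every $x\in(0,1]$, \[ \operatorname*{w^*\text{-}lim}_{n\to\infty}\; x\log(n)\sum_{h\in W_{q,n}}|h'(x)|\,\delta_{h.x}=m, \] i.e. for every continuous $f\colon[0,1]\to\mathbb{R}$, $x\log(n)\sum_{h\in W_{q,n}}|h'(x)|f(h.x)\to\int_{[0,1]}f\,dm$ as $n\to\infty$.
   Context: Setup. Let $q\geq 3$ be odd and $\lambda=\lambda_q=2\cos(\pi/q)$. Elements of $\mathrm{PGL}_2(\mathbb{R})$ are written as matrices $\begin{bmatrix}a&b\\c&d\end{bmatrix}$ (a matrix and its nonzero scalar multiples represent the same element); they act on $\mathbb{R}\cup\{\infty\}$ by $x\mapsto (ax+b)/(cx+d)$, written $g.x$. The Hecke triangle group $\Gamma_q\subset\mathrm{PSL}_2(\mathbb{R})$ is generated by $T=\begin{bmatrix}1&\lambda\\0&1\end{bmatrix}$ and $S=\begin{bmatrix}0&1\\-1&0\end{bmatrix}$. Put $s(x)=\sin(x\pi/q)/\sin(\pi/q)$, $g_k=\begin{bmatrix}s(k)&-s(k+1)\\-s(k-1)&s(k)\end{bmatrix}\in\Gamma_q$ for $k\in\mathbb{Z}$, and $Q=\begin{bmatrix}0&1\\1&0\end{bmatrix}$. Let $K=\{(q+1)/2,\dots,q-1\}$. Let $\Lambda_q=\{g_k^{-1},(Qg_k)^{-1}:k\in K\}$; the semigroup in $\mathrm{PGL}_2(\mathbb{R})$ generated by $\Lambda_q$ is free, and $W_{q,n}$ denotes the set of its elements that are words of length $n$ over $\Lambda_q$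 (products of $n$ elements of $\Lambda_q$). For $h\in W_{q,n}$, $h'(x)$ denotes the derivative of $x\mapsto h.x$. $m$ is Lebesgue measure on $[0,1]$ and $\delta_y$ the Dirac measure at $y$. *)

theory Defs
  imports "HOL-Analysis.Analysis"
begin

type_synonym mat2 = "real^2^2"

definition mk2 :: "real \<Rightarrow> real \<Rightarrow> real \<Rightarrow> real \<Rightarrow> mat2" where
  "mk2 a b c d = vector [vector [a, b], vector [c, d]]"

text \<open>lambda_q = 2 cos(pi/q) (context; not needed in the statement itself)\<close>
definition hecke_lambda :: "nat \<Rightarrow> real" where
  "hecke_lambda q = 2 * cos (pi / real q)"

definition sq :: "nat \<Rightarrow> real \<Rightarrow> real" where
  "sq q x = sin (x * pi / real q) / sin (pi / real q)"

definition gmat :: "nat \<Rightarrow> int \<Rightarrow> mat2" where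
  "gmat q k = mk2 (sq q (of_int k)) (- sq q (of_int (k + 1)))
                  (- sq q (of_int (k - 1))) (sq q (of_int k))"

definition Qmat :: mat2 where
  "Qmat = mk2 0 1 1 0"

definition Kset :: "nat \<Rightarrow> int set" where
  "Kset q = {(int q + 1) div 2 .. int q - 1}"

definition LambdaSet :: "nat \<Rightarrow> mat2 set" where
  "LambdaSet q = (\<lambda>k. matrix_inv (gmat q k)) ` Kset q
               \<union> (\<lambda>k. matrix_inv (Qmat ** gmat q k)) ` Kset q"

text \<open>Action of a matrix (as element of PGL_2(R)) on real numbers: g.x\<close>
definition mob :: "mat2 \<Rightarrow> real \<Rightarrow> real" where
  "mob A x = (A$1$1 * x + A$1$2) / (A$2$1 * x + A$2$2)"

text \<open>W_{q,n}: elements of the semigroup given by words of length n over Lambda_q,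
  each element represented by its action x \<mapsto> h.x (which determines it in PGL_2(R)).\<close>
definition Wset :: "nat \<Rightarrow> nat \<Rightarrow> (real \<Rightarrow> real) set" where
  "Wset q n = {mob (foldr (**) ws (mat 1)) | ws. set ws \<subseteq> LambdaSet q \<and> length ws = n}"

end

theory Submission
  imports Defs "HOL-Real_Asymp.Real_Asymp"
begin

text \<open>
  The sum over words is the \<open>n\<close>-th power of a transfer operator with invariant density \<open>1 / x\<close>;
  conjugated by this density it becomes a Markov operator \<open>P\<close>, and the claim reads
  \<open>log n \<cdot> P\<^sup>n (y f(y)) (x) \<longlonglongrightarrow> \<integral> f\<close>. Three ideas avoid general infinite ergodic theory.

  (1) \<open>P\<close> preserves the increasing concave functions, and \<open>P u \<le> (P u)(1)\<close> for these. Hence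
  \<open>a\<^sub>n = (P\<^sup>n \<Psi>)(1)\<close> is decreasing for every increasing concave \<open>\<Psi>\<close>. Decomposing \<open>P\<^sup>n 1 = 1\<close>
  according to the last step that does not use the parabolic branch yields, for a suitable \<open>\<Psi>\<close>,
  the renewal equation \<open>1 \<approx> \<Sum>\<^sub>k a\<^sub>k / (\<lambda> (n - k))\<close>, and monotonicity then forces \<open>a\<^sub>n \<sim> \<lambda> / log n\<close>.

  (2) The functions \<open>(1 + t y)\<^sup>-\<^sup>2\<close> with \<open>t \<ge> 0\<close> span a cone that is invariant under the operator. Following
  the parabolic branch for a long time and then using (1) shows that on this cone
  \<open>liminf log n \<cdot> P\<^sup>n (y f(y)) (x) \<ge> \<integral> f\<close>. Since \<open>\<Psi>(y) / y\<close> lies in the cone and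
  satisfies equality, so do \<open>1\<close> and then all \<open>(1 + t y)\<^sup>-\<^sup>2\<close> with \<open>t\<close> in the orbit of \<open>0\<close>.

  (3) This orbit accumulates at \<open>0\<close>, so the Taylor coefficients in \<open>t\<close> give all monomials, and
  Weierstrass approximation gives all continuous functions.
\<close>

section \<open>The Markov operator\<close>

text \<open>In terms of the paper, \<open>s j = s(j)\<close>, \<open>q = 2 p + 1\<close> and \<open>k = q - 1 - j\<close>, so that \<open>j = 0\<close> is the parabolic
  branch; \<open>al j\<close> is the action of \<open>g\<^sub>k\<^sup>-\<^sup>1\<close> and \<open>be j\<close> that of \<open>(Q g\<^sub>k)\<^sup>-\<^sup>1\<close>.\<close>

locale hecke_seq =
  fixes s :: "nat \<Rightarrow> real" and lam :: real and p :: nat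
  assumes p_pos: "0 < p"
    and s_0 [simp]: "s 0 = 0" and s_1 [simp]: "s (Suc 0) = 1"
    and s_rec: "s (Suc (Suc j)) = lam * s (Suc j) - s j"
    and s_less: "j < p \<Longrightarrow> s j < s (Suc j)"
    and s_fold: "s (Suc p) = s p"
    and lam_le: "lam \<le> 2"
begin

text \<open>The recurrence keeps \<open>s (Suc j) ^ 2 - s j * s (Suc (Suc j))\<close> constant in
  \<open>j\<close>, and at \<open>j = 0\<close> it is \<open>1\<close>. Up to sign this is the
  determinant of the branch matrices; it drives the telescoping sums below.\<close>

lemma s_det: "s (Suc j) * s (Suc j) = 1 + s j * s (Suc (Suc j))"
  by (induction j) (auto simp: s_rec algebra_simps)

lemma s_le_Suc: "j \<le> p \<Longrightarrow> s j \<le> s (Suc j)"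
  using s_less[of j] s_fold by (cases "j = p") auto

lemma s_nonneg: "j \<le> p \<Longrightarrow> 0 \<le> s j"
proof (induction j)
  case (Suc j)
  then show ?case using s_less[of j] by simp
qed simp

lemma s_pos: assumes "j < p" shows "0 < s (Suc j)"
  using s_less[OF assms] s_nonneg[of j] assms by simp

lemma s_pos2: assumes "j < p" shows "0 < s (Suc (Suc j))"
  using s_pos[OF assms] s_le_Suc[of "Suc j"] assms by simp

lemma s_Suc_le_lam: assumes "j < p" shows "s (Suc (Suc j)) \<le> lam * s (Suc j)"
  using s_rec[of j] s_nonneg[of j] assms by simp

lemma lam_eq: "s (Suc (Suc 0)) = lam"
  by (simp add: s_rec)

lemma lam_ge_1: "1 \<le> lam"
  using s_le_Suc[of 1] p_pos lam_eq by simp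

lemma lam_pos: "0 < lam" using lam_ge_1 by simp

text \<open>Provides the condition \<open>a \<le> 2 * b\<close> for the concavity of
  \<open>x / (a * x + b) ^ 2\<close>; this is where \<open>lam \<le> 2\<close> enters.\<close>

lemma s_Suc_le_2: assumes "j < p" shows "s (Suc (Suc j)) \<le> 2 * s (Suc j)"
  using s_Suc_le_lam[OF assms] mult_right_mono[OF lam_le less_imp_le[OF s_pos[OF assms]]] by linarith

lemmas s_facts = s_nonneg[OF less_imp_le] s_pos s_pos2 s_less

section \<open>Inverse branches and their weights\<close>

definition al :: "nat \<Rightarrow> real \<Rightarrow> real" where
  "al j x = (s (Suc j) * x + s j) / (s (Suc (Suc j)) * x + s (Suc j))"

definition be :: "nat \<Rightarrow> real \<Rightarrow> real" where
  "be j x = (s (Suc j) + s j * x) / (s (Suc (Suc j)) + s (Suc j) * x)"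

text \<open>\<open>pa\<close> and \<open>pb\<close> are \<open>x |h'(x)| / h(x)\<close> for the two kinds of branches \<open>h\<close>.\<close>

definition pa :: "nat \<Rightarrow> real \<Rightarrow> real" where
  "pa j x = x / ((s (Suc (Suc j)) * x + s (Suc j)) * (s (Suc j) * x + s j))"

definition pb :: "nat \<Rightarrow> real \<Rightarrow> real" where
  "pb j x = x / ((s (Suc (Suc j)) + s (Suc j) * x) * (s (Suc j) + s j * x))"

text \<open>For \<open>u y = y * f y\<close> this is \<open>x\<close> times the sum of
  \<open>|h'(x)| * f (h x)\<close> over the \<open>2 * p\<close> inverse branches
  \<open>h\<close>.\<close>

definition Pop :: "(real \<Rightarrow> real) \<Rightarrow> real \<Rightarrow> real" where
  "Pop u x = (\<Sum>j<p. pa j x * u (al j x) + pb j x * u (be j x))"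

lemma lin_pos:
  assumes "j < p" "0 < x"
  shows "0 < s (Suc j) * x + s j" "0 < s (Suc (Suc j)) * x + s (Suc j)"
    "0 < s (Suc j) + s j * x" "0 < s (Suc (Suc j)) + s (Suc j) * x"
  using assms s_nonneg[of j] s_pos[of j] s_pos2[of j]
  by (auto intro!: add_pos_nonneg mult_pos_pos mult_nonneg_nonneg)

lemma al_pos: "j < p \<Longrightarrow> 0 < x \<Longrightarrow> 0 < al j x"
  and be_pos: "j < p \<Longrightarrow> 0 < x \<Longrightarrow> 0 < be j x"
  and pa_pos: "j < p \<Longrightarrow> 0 < x \<Longrightarrow> 0 < pa j x"
  and pb_pos: "j < p \<Longrightarrow> 0 < x \<Longrightarrow> 0 < pb j x"
  using lin_pos by (auto simp: al_def be_def pa_def pb_def)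

lemma al_less_1: assumes "j < p" "0 < x" shows "al j x < 1"
proof -
  have "s (Suc j) * x \<le> s (Suc (Suc j)) * x"
    using assms s_le_Suc[of "Suc j"] by (intro mult_right_mono) auto
  then show ?thesis using lin_pos[OF assms] s_less[OF assms(1)] by (simp add: al_def)
qed

lemma be_less_1: assumes "j < p" "0 < x" shows "be j x < 1"
proof -
  have "s j * x < s (Suc j) * x" "s (Suc j) \<le> s (Suc (Suc j))"
    using assms s_le_Suc[of "Suc j"] s_less[of j] by auto
  then show ?thesis using lin_pos[OF assms] by (simp add: be_def)
qed

text \<open>Consecutive values of \<open>s\<close> grow at most by the factor \<open>lam\<close>
  from index \<open>1\<close> on, which keeps every branch \<open>al j\<close> with
  \<open>j > 0\<close> uniformly away from \<open>0\<close>.\<close>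

lemma al_ge: assumes "j < p" "0 < j" "0 < x" "x \<le> 1" shows "inverse (1 + lam) \<le> al j x"
proof -
  obtain i where i: "j = Suc i" using assms by (cases j) auto
  have "s (Suc (Suc j)) * x \<le> lam * s (Suc j) * x"
    using assms s_Suc_le_lam[of j] by (intro mult_right_mono) auto
  moreover have "s (Suc j) \<le> lam * s j" using assms s_Suc_le_lam[of i] i by auto
  moreover have "0 \<le> s (Suc j) * x" "0 \<le> s j" using s_facts[of j] assms by auto
  ultimately have "s (Suc (Suc j)) * x + s (Suc j) \<le> (1 + lam) * (s (Suc j) * x + s j)"
    by (simp add: algebra_simps)
  then show ?thesis using lin_pos[OF assms(1,3)] lam_pos
    by (simp add: al_def divide_simps mult.commute)
qed

lemma be_ge: assumes "j < p" "0 < x" "x \<le> 1" shows "inverse (1 + lam) \<le> be j x"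
proof -
  have "s (Suc (Suc j)) \<le> lam * s (Suc j)" using s_Suc_le_lam assms by auto
  moreover have "s (Suc j) * x \<le> s (Suc j)"
    using s_facts[of j] assms by (simp add: mult_left_le)
  moreover have "0 \<le> lam * (s j * x)" "0 \<le> s j * x" using s_facts[of j] assms lam_pos by auto
  ultimately have "s (Suc (Suc j)) + s (Suc j) * x \<le> (1 + lam) * (s (Suc j) + s j * x)"
    by (simp add: algebra_simps)
  then show ?thesis using lin_pos[OF assms(1,2)] lam_pos
    by (simp add: be_def divide_simps mult.commute)
qed

text \<open>\<open>S i\<close> is the tail \<open>\<Sum>j=i..<p. pa j + pb j\<close> of the telescoping sum of the weights.\<close>

definition S :: "nat \<Rightarrow> real \<Rightarrow> real" where
  "S i x = (s (Suc i) ^ 2 - s i ^ 2) * (x / ((s (Suc i) * x + s i) * (s (Suc i) + s i * x)))"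

text \<open>Partial fractions: as the determinant is \<open>1\<close>, each weight is a difference
  of two simple terms, for instance
  \<open>pa j x = B * x / (B * x + A) - C * x / (C * x + B)\<close> in the notation of the
  proof.\<close>

lemma pa_pb: assumes "j < p" "0 < x" shows "pa j x + pb j x = S j x - S (Suc j) x"
proof -
  define A B C where "A = s j" "B = s (Suc j)" "C = s (Suc (Suc j))"
  note ABC = A_B_C_def
  have d: "B * B = 1 + A * C" using s_det[of j] by (simp add: ABC)
  have pos: "0 < B * x + A" "0 < C * x + B" "0 < B + A * x" "0 < C + B * x"
    using lin_pos[OF assms] by (auto simp: ABC)
  have S0: "S j x = B * x / (B * x + A) - A * x / (B + A * x)"
    using pos by (simp add: S_def ABC[symmetric] divide_simps power2_eq_square) (simp add: algebra_simps)
  have S1: "S (Suc j) x = C * x / (C * x + B) - B * x / (C + B * x)"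
    using pos by (simp add: S_def ABC[symmetric] divide_simps power2_eq_square) (simp add: algebra_simps)
  have "B * x / (B * x + A) - C * x / (C * x + B) = (B * B - A * C) * x / ((C * x + B) * (B * x + A))"
    using pos by (simp add: divide_simps) (simp add: algebra_simps)
  moreover have "B * x / (C + B * x) - A * x / (B + A * x) = (B * B - A * C) * x / ((C + B * x) * (B + A * x))"
    using pos by (simp add: divide_simps) (simp add: algebra_simps)
  ultimately show ?thesis unfolding S0 S1 using d by (simp add: pa_def pb_def ABC[symmetric])
qed

lemma S_0: "0 < x \<Longrightarrow> S 0 x = 1"
  by (simp add: S_def)

lemma S_p: "S p x = 0"
  by (simp add: S_def s_fold)

text \<open>The telescoping ends at \<open>S p x = 0\<close> by the fold
  \<open>s (Suc p) = s p\<close>. The identity expresses the invariance of the density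
  \<open>1 / x\<close>.\<close>

lemma weights_sum: assumes "0 < x" shows "(\<Sum>j<p. pa j x + pb j x) = 1"
proof -
  have "(\<Sum>j<p. pa j x + pb j x) = (\<Sum>j<p. S j x - S (Suc j) x)"
    using assms by (intro sum.cong) (auto simp: pa_pb)
  also have "\<dots> = S 0 x - S p x" by (rule sum_lessThan_telescope')
  finally show ?thesis using assms by (simp add: S_0 S_p)
qed

section \<open>Linearity and positivity of the operator and its iterates\<close>

lemma Pop_one: "0 < x \<Longrightarrow> Pop (\<lambda>_. c) x = c"
  using weights_sum by (simp add: Pop_def flip: distrib_right sum_distrib_right)

lemma Pop_cong: assumes "0 < x" "\<And>y. 0 < y \<Longrightarrow> y < 1 \<Longrightarrow> u y = v y" shows "Pop u x = Pop v x"
  unfolding Pop_def using assms al_pos be_pos al_less_1 be_less_1 by (intro sum.cong) auto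

lemma Pop_mono: assumes "0 < x" "\<And>y. 0 < y \<Longrightarrow> y < 1 \<Longrightarrow> u y \<le> v y" shows "Pop u x \<le> Pop v x"
  unfolding Pop_def using assms al_pos be_pos al_less_1 be_less_1 pa_pos pb_pos
  by (intro sum_mono add_mono mult_left_mono) (auto simp: less_imp_le)

lemma Pop_add: "Pop (\<lambda>y. u y + v y) x = Pop u x + Pop v x"
  by (simp add: Pop_def algebra_simps sum.distrib)

lemma Pop_cmult: "Pop (\<lambda>y. c * u y) x = c * Pop u x"
  by (simp add: Pop_def sum_distrib_left algebra_simps)

lemma Pop_sum: "Pop (\<lambda>y. \<Sum>i\<in>I. u i y) x = (\<Sum>i\<in>I. Pop (u i) x)"
  unfolding Pop_def by (simp add: sum_distrib_left sum.distrib sum.swap[of _ _ I])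

lemma Popn_cong: assumes "0 < x" "x \<le> 1" "\<And>y. 0 < y \<Longrightarrow> y \<le> 1 \<Longrightarrow> u y = v y"
  shows "(Pop ^^ n) u x = (Pop ^^ n) v x"
  using assms(1,2)
proof (induction n arbitrary: x)
  case (Suc n)
  then show ?case by (auto intro!: Pop_cong)
qed (use assms(3) in auto)

lemma Popn_mono: assumes "0 < x" "x \<le> 1" "\<And>y. 0 < y \<Longrightarrow> y \<le> 1 \<Longrightarrow> u y \<le> v y"
  shows "(Pop ^^ n) u x \<le> (Pop ^^ n) v x"
  using assms(1,2)
proof (induction n arbitrary: x)
  case (Suc n)
  then show ?case by (auto intro!: Pop_mono)
qed (use assms(3) in auto)

lemma Popn_add: "(Pop ^^ n) (\<lambda>y. u y + v y) = (\<lambda>x. (Pop ^^ n) u x + (Pop ^^ n) v x)"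
  by (induction n) (auto simp: Pop_add)

lemma Popn_cmult: "(Pop ^^ n) (\<lambda>y. c * u y) = (\<lambda>x. c * (Pop ^^ n) u x)"
  by (induction n) (auto simp: Pop_cmult)

lemma Popn_sum: "(Pop ^^ n) (\<lambda>y. \<Sum>i\<in>I. u i y) = (\<lambda>x. \<Sum>i\<in>I. (Pop ^^ n) (u i) x)"
  by (induction n) (auto simp: Pop_sum)

lemma Popn_const: assumes "0 < x" "x \<le> 1" shows "(Pop ^^ n) (\<lambda>_. c) x = c"
  using assms
proof (induction n arbitrary: x)
  case (Suc n)
  have "Pop ((Pop ^^ n) (\<lambda>_. c)) x = Pop (\<lambda>_. c) x"
    using Suc by (intro Pop_cong) auto
  then show ?case using Suc Pop_one by simp
qed simp

lemma Popn_Suc: "(Pop ^^ Suc n) u = (Pop ^^ n) (Pop u)"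
  by (simp only: funpow_Suc_right o_def)

lemma Popn_nonneg: assumes "0 < x" "x \<le> 1" "\<And>y. 0 < y \<Longrightarrow> y \<le> 1 \<Longrightarrow> 0 \<le> u y"
  shows "0 \<le> (Pop ^^ n) u x"
  using Popn_mono[OF assms(1,2), of "\<lambda>_. 0" u n] assms(3) Popn_const[OF assms(1,2), of n 0] by simp

end

section \<open>Increasing concave functions\<close>

text \<open>Concavity on \<open>(0,1]\<close> is expressed by tangents, so that no derivatives of the iterates are needed.\<close>

definition has_tangent :: "(real \<Rightarrow> real) \<Rightarrow> real \<Rightarrow> real \<Rightarrow> bool" where
  "has_tangent F x0 d \<longleftrightarrow> (\<forall>x. 0 < x \<longrightarrow> x \<le> 1 \<longrightarrow> F x \<le> F x0 + d * (x - x0))"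

lemma has_tangentD: "has_tangent F x0 d \<Longrightarrow> 0 < x \<Longrightarrow> x \<le> 1 \<Longrightarrow> F x \<le> F x0 + d * (x - x0)"
  by (simp add: has_tangent_def)

lemma has_tangent_add: "has_tangent F x0 d \<Longrightarrow> has_tangent G x0 e \<Longrightarrow> has_tangent (\<lambda>x. F x + G x) x0 (d + e)"
  unfolding has_tangent_def by (auto simp: algebra_simps) (smt (verit))

lemma has_tangent_cmult: assumes "has_tangent F x0 d" "0 \<le> c" shows "has_tangent (\<lambda>x. c * F x) x0 (c * d)"
  unfolding has_tangent_def
proof (intro allI impI)
  fix x :: real assume "0 < x" "x \<le> 1"
  from mult_left_mono[OF has_tangentD[OF assms(1) this] assms(2)]
  show "c * F x \<le> c * F x0 + c * d * (x - x0)" by (simp add: algebra_simps)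
qed

lemma has_tangent_const: "has_tangent (\<lambda>_. c) x0 0"
  by (simp add: has_tangent_def)

lemma has_tangent_sum: assumes "\<And>i. i \<in> I \<Longrightarrow> has_tangent (F i) x0 (d i)"
  shows "has_tangent (\<lambda>x. \<Sum>i\<in>I. F i x) x0 (\<Sum>i\<in>I. d i)"
  using assms
proof (induction I rule: infinite_finite_induct)
  case (insert i I)
  then show ?case using has_tangent_add[of "F i" x0 "d i" "\<lambda>x. \<Sum>i\<in>I. F i x" "\<Sum>i\<in>I. d i"] by simp
qed (auto simp: has_tangent_def)

lemma has_tangent_cong: assumes "has_tangent F x0 d" "0 < x0" "x0 \<le> 1" "\<And>x. 0 < x \<Longrightarrow> x \<le> 1 \<Longrightarrow> F x = G x"
  shows "has_tangent G x0 d"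
  using assms unfolding has_tangent_def by metis

text \<open>After clearing denominators, tangent line minus function becomes
  \<open>(x - x0) ^ 2\<close> times \<open>a * (a * (b - a * x0) * x + 2 * b ^ 2)\<close>;
  \<open>a \<le> 2 * b\<close> keeps this nonnegative on \<open>(0,1]\<close>.\<close>

lemma has_tangent_square_denominator:
  assumes "0 < x0" "x0 \<le> 1" "0 \<le> a" "0 < b" "a \<le> 2 * b"
  shows "has_tangent (\<lambda>x. x / (a * x + b)\<^sup>2) x0 ((b - a * x0) / (a * x0 + b) ^ 3)"
  unfolding has_tangent_def
proof (intro allI impI)
  fix x :: real assume x: "0 < x" "x \<le> 1"
  define D E where "D = a * x0 + b" "E = a * x + b"
  have pos: "0 < D" "0 < E" using assms x by (auto simp: D_E_def intro!: add_nonneg_pos)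
  have "0 \<le> a * (b - a * x0) * x + 2 * b\<^sup>2"
  proof (cases "a * x0 \<le> b")
    case True
    then show ?thesis using assms x by auto
  next
    case False
    have "a * x0 \<le> a" using assms by (simp add: mult_left_le)
    then have "a * (a * x0 - b) \<le> (2 * b) * b"
      using False assms by (intro mult_mono) auto
    moreover have "a * (a * x0 - b) * x \<le> a * (a * x0 - b)"
      using False assms x by (intro mult_left_le) auto
    ultimately show ?thesis by (simp add: power2_eq_square algebra_simps)
  qed
  then have "0 \<le> (x - x0)\<^sup>2 * (a * (a * (b - a * x0) * x + 2 * b\<^sup>2))"
    using assms by auto
  also have "\<dots> = (x0 * D + (b - a * x0) * (x - x0)) * E\<^sup>2 - x * D ^ 3"
    by (simp add: D_E_def power2_eq_square power3_eq_cube algebra_simps)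
  finally have "x * D ^ 3 \<le> (x0 * D + (b - a * x0) * (x - x0)) * E\<^sup>2" by simp
  then have "x / E\<^sup>2 \<le> (x0 * D + (b - a * x0) * (x - x0)) / D ^ 3"
    using pos by (simp add: divide_simps mult.commute)
  also have "\<dots> = x0 / D\<^sup>2 + (b - a * x0) / D ^ 3 * (x - x0)"
    using pos by (simp add: field_simps power2_eq_square power3_eq_cube)
  finally show "x / (a * x + b)\<^sup>2 \<le> x0 / (a * x0 + b)\<^sup>2 + (b - a * x0) / (a * x0 + b) ^ 3 * (x - x0)"
    by (simp add: D_E_def)
qed

text \<open>Here the cleared remainder is \<open>(x - x0) ^ 2\<close> times
  \<open>C * (A - C * x0 ^ 2) * x + A * (B + 2 * C * x0)\<close>. For \<open>C = A\<close> the slope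
  vanishes at \<open>x0 = 1\<close>.\<close>

lemma has_tangent_quadratic_denominator:
  assumes "0 < x0" "x0 \<le> 1" "0 \<le> C" "C \<le> A" "0 < B"
  shows "has_tangent (\<lambda>x. x / (A + B * x + C * x\<^sup>2)) x0 ((A - C * x0\<^sup>2) / (A + B * x0 + C * x0\<^sup>2)\<^sup>2)"
  unfolding has_tangent_def
proof (intro allI impI)
  fix x :: real assume x: "0 < x" "x \<le> 1"
  define D E where "D = A + B * x0 + C * x0\<^sup>2" "E = A + B * x + C * x\<^sup>2"
  have "0 < A + B * y + C * y\<^sup>2" if "0 < y" for y :: real
    using assms that by (intro add_pos_nonneg add_nonneg_pos) auto
  then have pos: "0 < D" "0 < E" using assms x by (auto simp: D_E_def)
  have "C * x0\<^sup>2 \<le> C" using assms by (intro mult_left_le power_le_one) auto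
  then have "C * x0\<^sup>2 \<le> A" using assms by simp
  then have "0 \<le> (x - x0)\<^sup>2 * (C * (A - C * x0\<^sup>2) * x + A * (B + 2 * C * x0))"
    using assms x by (intro mult_nonneg_nonneg add_nonneg_nonneg) auto
  also have "\<dots> = (x0 * D + (A - C * x0\<^sup>2) * (x - x0)) * E - x * D\<^sup>2"
    by (simp add: D_E_def power2_eq_square algebra_simps)
  finally have "x * D\<^sup>2 \<le> (x0 * D + (A - C * x0\<^sup>2) * (x - x0)) * E" by simp
  then have "x / E \<le> (x0 * D + (A - C * x0\<^sup>2) * (x - x0)) / D\<^sup>2"
    using pos by (simp add: divide_simps mult.commute)
  also have "\<dots> = x0 / D + (A - C * x0\<^sup>2) / D\<^sup>2 * (x - x0)"
    using pos by (simp add: field_simps power2_eq_square)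
  finally show "x / (A + B * x + C * x\<^sup>2) \<le>
      x0 / (A + B * x0 + C * x0\<^sup>2) + (A - C * x0\<^sup>2) / (A + B * x0 + C * x0\<^sup>2)\<^sup>2 * (x - x0)"
    by (simp add: D_E_def)
qed

text \<open>Increasing concave functions on \<open>(0,1)\<close>; \<open>0 \<le> l\<close> encodes nonnegativity at \<open>0\<close>.\<close>

definition incr_concave :: "(real \<Rightarrow> real) \<Rightarrow> bool" where
  "incr_concave u \<longleftrightarrow> (\<forall>y. 0 < y \<longrightarrow> y < 1 \<longrightarrow>
     (\<exists>l m. 0 \<le> l \<and> 0 \<le> m \<and> u y = l + m * y \<and> (\<forall>z. 0 < z \<longrightarrow> z < 1 \<longrightarrow> u z \<le> l + m * z)))"

text \<open>A maximum at \<open>1\<close> forces nonnegative tangent slopes, and a negative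
  intercept would make the function negative near \<open>0\<close>.\<close>

lemma incr_concaveI:
  assumes nonneg: "\<And>y. 0 < y \<Longrightarrow> y < 1 \<Longrightarrow> 0 \<le> F y"
    and has_tangent: "\<And>y. 0 < y \<Longrightarrow> y < 1 \<Longrightarrow> \<exists>d. has_tangent F y d"
    and le: "\<And>y. 0 < y \<Longrightarrow> y < 1 \<Longrightarrow> F y \<le> F 1"
  shows "incr_concave F"
  unfolding incr_concave_def
proof (intro allI impI)
  fix y :: real assume y: "0 < y" "y < 1"
  obtain d where d: "has_tangent F y d" using has_tangent[OF y] by blast
  have "0 \<le> d * (1 - y)" using has_tangentD[OF d, of 1] le[OF y] by simp
  then have d0: "0 \<le> d" using y by (simp add: zero_le_mult_iff)
  define l where "l = F y - d * y"
  have line: "F z \<le> l + d * z" if "0 < z" "z \<le> 1" for z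
    using has_tangentD[OF d that] by (simp add: l_def algebra_simps)
  have "0 \<le> l"
  proof (rule ccontr)
    assume "\<not> 0 \<le> l"
    \<comment> \<open>Small enough that \<open>d * e \<le> - l / 2\<close>, so the tangent line is
      at most \<open>l / 2\<close> at \<open>e\<close>.\<close>
    define e where "e = min (1/2) (- l / (2 * (d + 1)))"
    have e: "0 < e" "e < 1" "e \<le> - l / (2 * (d + 1))"
      using \<open>\<not> 0 \<le> l\<close> d0 by (auto simp: e_def intro!: divide_neg_pos)
    have "e * (2 * (d + 1)) \<le> - l"
      using e(3) d0 by (subst (asm) pos_le_divide_eq) auto
    then have "d * e \<le> - l / 2" using e by (simp add: algebra_simps)
    moreover have "0 \<le> l + d * e" using nonneg[of e] line[of e] e by simp
    ultimately show False using \<open>\<not> 0 \<le> l\<close> by simp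
  qed
  then show "\<exists>l m. 0 \<le> l \<and> 0 \<le> m \<and> F y = l + m * y \<and> (\<forall>z. 0 < z \<longrightarrow> z < 1 \<longrightarrow> F z \<le> l + m * z)"
    using d0 line by (intro exI[of _ l] exI[of _ d]) (auto simp: l_def)
qed

lemma incr_concave_mono: assumes "incr_concave u" "0 < y" "y \<le> z" "z < 1" shows "u y \<le> u z"
proof -
  obtain l m where lm: "0 \<le> m" "u z = l + m * z" "u y \<le> l + m * y"
    using assms unfolding incr_concave_def by (meson le_less_trans less_le_trans)
  then show ?thesis using mult_left_mono[OF assms(3) lm(1)] by simp
qed

text \<open>For \<open>y < z\<close>, adding the last two hypotheses gives
  \<open>m' \<le> m\<close>: slopes of supporting lines decrease, hence their intercepts
  increase.\<close>

lemma supporting_intercepts_mono: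
  fixes y z :: real
  assumes "y \<le> z" "0 < y" "z = y \<Longrightarrow> l = l'"
    and "l + m * y \<le> l' + m' * y" "l' + m' * z \<le> l + m * z"
  shows "l \<le> l'"
proof (cases "y = z")
  case False
  then have "0 < z - y" using assms by simp
  moreover have "0 \<le> (m - m') * (z - y)" using assms by (simp add: algebra_simps)
  ultimately have "m' * y \<le> m * y" using assms by (simp add: zero_le_mult_iff)
  then show ?thesis using assms by linarith
qed (use assms in auto)

section \<open>The operator preserves increasing concave functions\<close>

context hecke_seq
begin

lemma al_le_be: assumes "j < p" "0 < x" "x \<le> 1" shows "al j x \<le> be j x"
proof -
  have "0 \<le> (s (Suc j) * s (Suc j) - s j * s (Suc (Suc j))) * (1 - x * x)"
    using assms by (auto simp: s_det intro: mult_le_one)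
  then show ?thesis using lin_pos[OF assms(1,2)]
    by (simp add: al_def be_def divide_simps) (simp add: algebra_simps)
qed

text \<open>Both sides are compared with \<open>s (Suc j) / s (Suc (Suc j))\<close>, the common
  endpoint of the images of the positive axis under neighbouring branches.\<close>

lemma al_mono: assumes "Suc j < p" "0 < x" shows "al j x \<le> al (Suc j) x"
proof -
  define A B C D where "A = s j" "B = s (Suc j)" "C = s (Suc (Suc j))" "D = s (Suc (Suc (Suc j)))"
  note ABC = A_B_C_D_def
  have d: "B * B = 1 + A * C" "C * C = 1 + B * D" using s_det by (simp_all add: ABC)
  have pos: "0 < C * x + B" "0 < D * x + C" "0 < C"
    using lin_pos[of j x] lin_pos[of "Suc j" x] s_pos2[of j] assms by (auto simp: ABC)
  have "C * (B * x + A) \<le> B * (C * x + B)" using d by (simp add: algebra_simps)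
  then have "al j x \<le> B / C" using pos by (simp add: al_def ABC[symmetric] divide_simps mult.commute)
  moreover have "B * (D * x + C) \<le> C * (C * x + B)"
    using d assms by (simp add: algebra_simps)
  then have "B / C \<le> al (Suc j) x" using pos by (simp add: al_def ABC[symmetric] divide_simps mult.commute)
  ultimately show ?thesis by simp
qed

lemma al_be_1: "al j 1 = be j 1"
  by (simp add: al_def be_def add.commute)

lemma pa_al: "j < p \<Longrightarrow> 0 < x \<Longrightarrow> pa j x * al j x = x / (s (Suc (Suc j)) * x + s (Suc j))\<^sup>2"
  using lin_pos[of j x] by (simp add: pa_def al_def power2_eq_square)

lemma pb_be: "j < p \<Longrightarrow> 0 < x \<Longrightarrow> pb j x * be j x = x / (s (Suc j) * x + s (Suc (Suc j)))\<^sup>2"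
  using lin_pos[of j x] by (simp add: pb_def be_def power2_eq_square add.commute)

lemma has_tangent_pb: assumes "j < p" "0 < x0" "x0 \<le> 1" shows "\<exists>d. has_tangent (pb j) x0 d"
proof -
  define A B C where "A = s j" "B = s (Suc j)" "C = s (Suc (Suc j))"
  note ABC = A_B_C_def
  have "0 \<le> A" "0 < B" "A \<le> B" "B \<le> C"
    using assms s_facts[of j] s_le_Suc[of "Suc j"] by (auto simp: ABC)
  then have "has_tangent (\<lambda>x. x / (C * B + (C * A + B * B) * x + (B * A) * x\<^sup>2)) x0
     ((C * B - (B * A) * x0\<^sup>2) / (C * B + (C * A + B * B) * x0 + (B * A) * x0\<^sup>2)\<^sup>2)"
    using assms by (intro has_tangent_quadratic_denominator mult_mono add_nonneg_pos) (auto simp: mult.commute)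
  moreover have "pb j = (\<lambda>x. x / (C * B + (C * A + B * B) * x + (B * A) * x\<^sup>2))"
    by (auto simp: pb_def ABC[symmetric] fun_eq_iff algebra_simps power2_eq_square)
  ultimately show ?thesis by auto
qed

text \<open>The denominator is palindromic, so \<open>S i\<close> is invariant under the exchange of
  \<open>x\<close> and \<open>1 / x\<close> and its slope at \<open>1\<close> is zero; monotonicity
  of \<open>s\<close> makes the prefactor nonnegative.\<close>

lemma has_tangent_S: assumes "i < p" "0 < x0" "x0 \<le> 1" shows "\<exists>d. has_tangent (S i) x0 d \<and> (x0 = 1 \<longrightarrow> d = 0)"
proof -
  define A B where "A = s i" "B = s (Suc i)"
  note ABC = A_B_def
  have "0 \<le> A" "0 < B" "A \<le> B"
    using assms s_facts[of i] s_le_Suc[of i] by (auto simp: ABC)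
  then have "has_tangent (\<lambda>x. (B\<^sup>2 - A\<^sup>2) * (x / (A * B + (A * A + B * B) * x + (A * B) * x\<^sup>2))) x0
     ((B\<^sup>2 - A\<^sup>2) * ((A * B - (A * B) * x0\<^sup>2) / (A * B + (A * A + B * B) * x0 + (A * B) * x0\<^sup>2)\<^sup>2))"
    using assms by (intro has_tangent_cmult has_tangent_quadratic_denominator add_nonneg_pos) (auto simp: power_mono)
  moreover have "(B * x + A) * (B + A * x) = A * B + (A * A + B * B) * x + (A * B) * x\<^sup>2" for x
    by (simp add: algebra_simps power2_eq_square)
  then have "S i = (\<lambda>x. (B\<^sup>2 - A\<^sup>2) * (x / (A * B + (A * A + B * B) * x + (A * B) * x\<^sup>2)))"
    unfolding S_def ABC[symmetric] by simp
  ultimately show ?thesis by auto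
qed

text \<open>Summation by parts: an increasing \<open>c\<close> yields nonnegative coefficients for
  the tails \<open>g\<close>.\<close>

lemma abel_sum:
  fixes c g :: "nat \<Rightarrow> real"
  shows "(\<Sum>j<Suc n. c j * (g j - g (Suc j)))
    = c 0 * g 0 + (\<Sum>j<n. (c (Suc j) - c j) * g (Suc j)) - c n * g (Suc n)"
  by (induction n) (simp_all add: algebra_simps)

text \<open>Supporting lines of \<open>u\<close> at the images of \<open>x0\<close> give a majorant
  \<open>Q\<close> of \<open>Pop u\<close> that touches at \<open>x0\<close>. Summing its intercepts
  by parts against the tails \<open>S\<close> makes \<open>Q\<close>, up to a constant, a
  nonnegative combination of functions with known tangents. At \<open>x0 = 1\<close> both branches
  of index \<open>j\<close> have the same image, and the slopes vanish.\<close>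

lemma has_tangent_Pop:
  assumes u: "incr_concave u" and x0: "0 < x0" "x0 \<le> 1"
  shows "\<exists>d. has_tangent (Pop u) x0 d \<and> (x0 = 1 \<longrightarrow> d = 0)"
proof -
  \<comment> \<open>Choose for each \<open>y\<close> one supporting line, with intercept
    \<open>L y\<close> and slope \<open>M y\<close>.\<close>
  have "\<forall>y. \<exists>l m. 0 < y \<longrightarrow> y < 1 \<longrightarrow>
     0 \<le> l \<and> 0 \<le> m \<and> u y = l + m * y \<and> (\<forall>z. 0 < z \<longrightarrow> z < 1 \<longrightarrow> u z \<le> l + m * z)"
    using u unfolding incr_concave_def by blast
  from choice[OF this] obtain L where "\<forall>y. \<exists>m. 0 < y \<longrightarrow> y < 1 \<longrightarrow>
     0 \<le> L y \<and> 0 \<le> m \<and> u y = L y + m * y \<and> (\<forall>z. 0 < z \<longrightarrow> z < 1 \<longrightarrow> u z \<le> L y + m * z)" ..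
  from choice[OF this] obtain M where "\<forall>y. 0 < y \<longrightarrow> y < 1 \<longrightarrow>
     0 \<le> L y \<and> 0 \<le> M y \<and> u y = L y + M y * y \<and> (\<forall>z. 0 < z \<longrightarrow> z < 1 \<longrightarrow> u z \<le> L y + M y * z)" ..
  then have LM: "\<And>y. 0 < y \<Longrightarrow> y < 1 \<Longrightarrow> 0 \<le> L y" "\<And>y. 0 < y \<Longrightarrow> y < 1 \<Longrightarrow> 0 \<le> M y"
    "\<And>y. 0 < y \<Longrightarrow> y < 1 \<Longrightarrow> u y = L y + M y * y"
    "\<And>y z. 0 < y \<Longrightarrow> y < 1 \<Longrightarrow> 0 < z \<Longrightarrow> z < 1 \<Longrightarrow> u z \<le> L y + M y * z"
    by blast+
  have L_mono: "L y \<le> L z" if "0 < y" "y \<le> z" "z < 1" for y z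
  proof -
    have yz: "0 < z" "y < 1" using that by auto
    have 1: "L y + M y * y \<le> L z + M z * y"
      using LM(3)[OF that(1) yz(2)] LM(4)[OF yz(1) that(3) that(1) yz(2)] by linarith
    have 2: "L z + M z * z \<le> L y + M y * z"
      using LM(3)[OF yz(1) that(3)] LM(4)[OF that(1) yz(2) yz(1) that(3)] by linarith
    show ?thesis by (rule supporting_intercepts_mono[OF that(2,1) _ 1 2]) simp
  qed
  define la ma lb mb where "la j = L (al j x0)" and "ma j = M (al j x0)"
    and "lb j = L (be j x0)" and "mb j = M (be j x0)" for j
  have in01: "0 < al j x" "al j x < 1" "0 < be j x" "be j x < 1" if "j < p" "0 < x" for j x
    using that al_pos al_less_1 be_pos be_less_1 by auto
  define Q where "Q x = (\<Sum>j<p. pa j x * (la j + ma j * al j x) + pb j x * (lb j + mb j * be j x))" for x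
  have Q_ge: "Pop u x \<le> Q x" if "0 < x" for x
    unfolding Pop_def Q_def la_def ma_def lb_def mb_def
    using that x0 in01 pa_pos pb_pos LM(4)
    by (intro sum_mono add_mono mult_left_mono) (auto simp: less_imp_le)
  have Q_eq: "Pop u x0 = Q x0"
    unfolding Pop_def Q_def la_def ma_def lb_def mb_def
    using x0 in01 LM(3) by (intro sum.cong) auto
  obtain n where n: "p = Suc n" using p_pos by (cases p) auto
  define V where "V j x = ma j * (x / (s (Suc (Suc j)) * x + s (Suc j))\<^sup>2)
     + mb j * (x / (s (Suc j) * x + s (Suc (Suc j)))\<^sup>2)" for j x
  \<comment> \<open>Splitting \<open>lb j = la j + (lb j - la j)\<close> pairs the common intercept
    with \<open>pa j + pb j\<close>, which telescopes.\<close>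
  have Q_alt: "Q x = la 0 + (\<Sum>j<n. (la (Suc j) - la j) * S (Suc j) x)
      + ((\<Sum>j<p. (lb j - la j) * pb j x) + (\<Sum>j<p. V j x))" if "0 < x" for x
  proof -
    have "Q x = (\<Sum>j<p. la j * (pa j x + pb j x) + ((lb j - la j) * pb j x
       + (ma j * (pa j x * al j x) + mb j * (pb j x * be j x))))"
      unfolding Q_def by (intro sum.cong) (auto simp: algebra_simps)
    also have "\<dots> = (\<Sum>j<p. la j * (S j x - S (Suc j) x) + ((lb j - la j) * pb j x + V j x))"
      using that by (intro sum.cong) (auto simp: pa_pb pa_al pb_be V_def)
    also have "\<dots> = (\<Sum>j<p. la j * (S j x - S (Suc j) x)) + ((\<Sum>j<p. (lb j - la j) * pb j x) + (\<Sum>j<p. V j x))"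
      by (simp only: sum.distrib)
    also have "(\<Sum>j<p. la j * (S j x - S (Suc j) x)) = la 0 + (\<Sum>j<n. (la (Suc j) - la j) * S (Suc j) x)"
      unfolding n abel_sum[of la "\<lambda>j. S j x" n] using S_0[OF that] S_p[of x] n by simp
    finally show ?thesis .
  qed
  have "\<forall>j. \<exists>d. j < p \<longrightarrow> has_tangent (S j) x0 d \<and> (x0 = 1 \<longrightarrow> d = 0)"
    using has_tangent_S x0 by blast
  then obtain dS where dS: "\<And>j. j < p \<Longrightarrow> has_tangent (S j) x0 (dS j)" "\<And>j. j < p \<Longrightarrow> x0 = 1 \<Longrightarrow> dS j = 0"
    by metis
  have "\<forall>j. \<exists>d. j < p \<longrightarrow> has_tangent (pb j) x0 d"
    using has_tangent_pb x0 by blast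
  then obtain dp where dp: "\<And>j. j < p \<Longrightarrow> has_tangent (pb j) x0 (dp j)"
    by metis
  define dV where "dV j = ma j * ((s (Suc j) - s (Suc (Suc j)) * x0) / (s (Suc (Suc j)) * x0 + s (Suc j)) ^ 3)
     + mb j * ((s (Suc (Suc j)) - s (Suc j) * x0) / (s (Suc j) * x0 + s (Suc (Suc j))) ^ 3)" for j
  have tV: "has_tangent (V j) x0 (dV j)" if "j < p" for j
  proof -
    have "0 \<le> ma j" "0 \<le> mb j" using LM in01 that x0 by (auto simp: ma_def mb_def)
    then show ?thesis unfolding V_def dV_def
      using that x0 s_facts[of j] s_Suc_le_2[of j] s_le_Suc[of "Suc j"]
      by (intro has_tangent_add has_tangent_cmult has_tangent_square_denominator) auto
  qed
  \<comment> \<open>Ordered image points have ordered intercepts; hence the coefficients of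
    \<open>S\<close> and \<open>pb\<close> are nonnegative.\<close>
  have la_mono: "la j \<le> la (Suc j)" if "j < n" for j
    unfolding la_def using that n x0 in01[of j x0] in01[of "Suc j" x0] al_mono[of j x0] by (intro L_mono) auto
  have lab: "la j \<le> lb j" if "j < p" for j
    unfolding la_def lb_def using that x0 in01[of j x0] al_le_be[of j x0] by (intro L_mono) auto
  define d where "d = 0 + (\<Sum>j<n. (la (Suc j) - la j) * dS (Suc j))
     + ((\<Sum>j<p. (lb j - la j) * dp j) + (\<Sum>j<p. dV j))"
  have "has_tangent (\<lambda>x. la 0 + (\<Sum>j<n. (la (Suc j) - la j) * S (Suc j) x)
      + ((\<Sum>j<p. (lb j - la j) * pb j x) + (\<Sum>j<p. V j x))) x0 d"
    unfolding d_def using la_mono lab dS dp tV n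
    by (intro has_tangent_add has_tangent_const has_tangent_sum has_tangent_cmult) auto
  then have "has_tangent Q x0 d" by (rule has_tangent_cong[OF _ x0]) (simp add: Q_alt)
  then have "has_tangent (Pop u) x0 d"
    using Q_ge Q_eq unfolding has_tangent_def by (metis order_trans)
  moreover have "d = 0" if "x0 = 1"
  proof -
    have "dV j = 0" for j
      using that by (simp add: dV_def ma_def mb_def al_be_1 add.commute divide_simps) (simp add: algebra_simps)
    moreover have "la j = lb j" for j using that by (simp add: la_def lb_def al_be_1)
    ultimately show ?thesis using dS(2) that n by (simp add: d_def)
  qed
  ultimately show ?thesis by blast
qed

lemma incr_concave_nonneg: "incr_concave u \<Longrightarrow> 0 < y \<Longrightarrow> y < 1 \<Longrightarrow> 0 \<le> u y"
  unfolding incr_concave_def by (metis add_nonneg_nonneg less_imp_le mult_nonneg_nonneg)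

lemma Pop_le_at_1: assumes "incr_concave u" "0 < x" "x \<le> 1" shows "Pop u x \<le> Pop u 1"
  using has_tangent_Pop[OF assms(1), of 1] has_tangentD[OF _ assms(2,3)] by force

lemma incr_concave_Pop: assumes "incr_concave u" shows "incr_concave (Pop u)"
proof (rule incr_concaveI)
  show "0 \<le> Pop u y" if "0 < y" "y < 1" for y
    using Pop_mono[OF that(1), of "\<lambda>_. 0" u] incr_concave_nonneg[OF assms] Pop_one[OF that(1), of 0] by auto
  show "\<exists>d. has_tangent (Pop u) y d" if "0 < y" "y < 1" for y
    using has_tangent_Pop[OF assms, of y] that by auto
qed (use Pop_le_at_1[OF assms] in auto)

end

section \<open>Renewal asymptotics\<close>

text \<open>Stepwise integral comparison: \<open>ln r \<le> r - 1\<close> for the quotient of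
  consecutive denominators and for its inverse.\<close>

lemma sum_inverse_linear_bounds:
  fixes L :: real and n :: nat
  assumes "0 < L"
  shows "ln (n * L + 1) / L \<le> (\<Sum>j<n. 1 / (j * L + 1))"
    and "(\<Sum>j<Suc n. 1 / (j * L + 1)) \<le> 1 + ln (n * L + 1) / L"
proof -
  have pos: "0 < real j * L + 1" for j :: nat using assms by (auto intro: add_nonneg_pos)
  show "ln (n * L + 1) / L \<le> (\<Sum>j<n. 1 / (j * L + 1))"
  proof (induction n)
    case (Suc n)
    have "ln (Suc n * L + 1) - ln (n * L + 1) = ln ((Suc n * L + 1) / (n * L + 1))"
      using pos[of n] pos[of "Suc n"] by (simp add: ln_div del: of_nat_Suc)
    also have "\<dots> \<le> (Suc n * L + 1) / (n * L + 1) - 1"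
      using pos[of n] pos[of "Suc n"] by (intro ln_le_minus_one divide_pos_pos) auto
    also have "\<dots> = L * (1 / (n * L + 1))"
      using pos[of n] by (simp add: field_simps)
    finally have "ln (Suc n * L + 1) / L \<le> ln (n * L + 1) / L + 1 / (n * L + 1)"
      using assms by (simp add: field_simps del: of_nat_Suc)
    then show ?case using Suc.IH by simp
  qed simp
  show "(\<Sum>j<Suc n. 1 / (j * L + 1)) \<le> 1 + ln (n * L + 1) / L"
  proof (induction n)
    case (Suc n)
    have "ln (n * L + 1) - ln (Suc n * L + 1) = ln ((n * L + 1) / (Suc n * L + 1))"
      using pos[of n] pos[of "Suc n"] by (simp add: ln_div del: of_nat_Suc)
    also have "\<dots> \<le> (n * L + 1) / (Suc n * L + 1) - 1"
      using pos[of n] pos[of "Suc n"] by (intro ln_le_minus_one divide_pos_pos) auto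
    also have "\<dots> = - L * (1 / (Suc n * L + 1))"
      using pos[of "Suc n"] by (simp add: field_simps)
    finally have "1 / (Suc n * L + 1) \<le> ln (Suc n * L + 1) / L - ln (n * L + 1) / L"
      using assms by (simp add: field_simps del: of_nat_Suc)
    then show ?case using Suc.IH by (simp del: of_nat_Suc)
  qed simp
qed

text \<open>For the lower bound the renewal sum is split at \<open>m\<close> with \<open>n = m + m \<lceil>ln m\<rceil>\<close>:
  then the first part is negligible although \<open>ln n\<close> is still asymptotic to \<open>ln m\<close>.\<close>

lemma renewal_log_asymptotics:
  fixes a :: "nat \<Rightarrow> real" and L :: real
  assumes L: "0 < L" and dec: "decseq a" and nonneg: "\<And>n. 0 \<le> a n"
    and upper: "\<And>n. (\<Sum>k<n. a k / (real (n - 1 - k) * L + 1 + L)) \<le> 1"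
    and lower: "\<And>n. 1 - 1 / (1 + n * L) \<le> (\<Sum>k<n. a k / (real (n - 1 - k) * L + 1))"
  shows "(\<lambda>n. ln n * a n) \<longlonglongrightarrow> L"
proof -
  define T where "T n = (\<Sum>j<n. 1 / (real j * L + 1))" for n
  have pos: "0 < real j * L + 1" for j :: nat using L by (auto intro: add_nonneg_pos)
  have rev: "(\<Sum>k<n. g (n - 1 - k)) = (\<Sum>k<n. g k)" for g :: "nat \<Rightarrow> real" and n
    using sum.nat_diff_reindex[of g n] by simp
  have a_le: "a j \<le> a i" if "i \<le> j" for i j using dec that by (auto simp: decseq_def)
  \<comment> \<open>For \<open>k < n\<close> monotonicity replaces \<open>a k\<close> by the smaller
    \<open>a n\<close>; the remaining kernel sum is \<open>T (Suc n) - 1\<close>.\<close>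
  have upper': "a n * (ln (real (Suc n) * L + 1) / L - 1) \<le> 1" for n
  proof -
    have "T (Suc n) = 1 + (\<Sum>j<n. 1 / (real j * L + 1 + L))"
      unfolding T_def by (subst sum.lessThan_Suc_shift) (simp add: algebra_simps)
    also have "(\<Sum>j<n. 1 / (real j * L + 1 + L)) = (\<Sum>k<n. 1 / (real (n - 1 - k) * L + 1 + L))"
      by (rule rev[symmetric])
    finally have "a n * (T (Suc n) - 1) = (\<Sum>k<n. a n / (real (n - 1 - k) * L + 1 + L))"
      by (simp add: sum_distrib_left)
    also have "\<dots> \<le> (\<Sum>k<n. a k / (real (n - 1 - k) * L + 1 + L))"
      using L pos a_le by (intro sum_mono divide_right_mono add_nonneg_nonneg) auto
    also have "\<dots> \<le> 1" by (rule upper)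
    finally have "a n * (T (Suc n) - 1) \<le> 1" .
    moreover have "a n * (ln (real (Suc n) * L + 1) / L - 1) \<le> a n * (T (Suc n) - 1)"
      using sum_inverse_linear_bounds(1)[OF L, of "Suc n"] nonneg[of n] unfolding T_def
      by (intro mult_left_mono) auto
    ultimately show ?thesis by simp
  qed
  have "eventually (\<lambda>n. 0 < ln (real (Suc n) * L + 1) / L - 1) at_top"
    using L by real_asymp
  moreover have "eventually (\<lambda>n. 0 < ln (real n)) at_top"
    by real_asymp
  ultimately have "eventually (\<lambda>n. 0 < ln (real (Suc n) * L + 1) / L - 1 \<and> 0 < ln (real n)) at_top"
    by (rule eventually_conj)
  then have up: "eventually (\<lambda>n. ln n * a n \<le> ln n / (ln (real (Suc n) * L + 1) / L - 1)) at_top"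
  proof eventually_elim
    case (elim n)
    then have "a n \<le> 1 / (ln (real (Suc n) * L + 1) / L - 1)"
      using upper'[of n] by (simp add: pos_le_divide_eq)
    then have "ln n * a n \<le> ln n * (1 / (ln (real (Suc n) * L + 1) / L - 1))"
      using elim by (intro mult_left_mono) auto
    then show ?case by simp
  qed
  have up_lim: "(\<lambda>n. ln n / (ln (real (Suc n) * L + 1) / L - 1)) \<longlonglongrightarrow> L"
    using L by real_asymp
  have "eventually (\<lambda>m. 1 < ln (real m)) at_top" by real_asymp
  then have low: "eventually (\<lambda>m. (1 - 1 / (1 + m * L) - a 0 / (ln m * L)) * ln m / (1 + ln ((ln m + 1) * m * L + 1) / L) \<le> ln m * a m) at_top"
  proof eventually_elim
    case (elim m)
    define K where "K = m * nat \<lceil>ln (real m)\<rceil>"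
    have m: "0 < m" using elim by (cases m) auto
    have "real (nat \<lceil>ln (real m)\<rceil>) = of_int \<lceil>ln (real m)\<rceil>" using elim by simp
    then have K: "ln m * m \<le> real K" "real K \<le> (ln m + 1) * m"
      unfolding K_def of_nat_mult by (auto simp: mult.commute intro!: mult_left_mono)
    have lnm: "0 < ln (real m) * real m" using less_trans[OF zero_less_one elim] m by (intro mult_pos_pos) auto
    then have K0: "0 < real K" using K by linarith
    have split: "(\<Sum>k<m + K. f k) = (\<Sum>k<m. f k) + (\<Sum>i<K. f (m + i))" for f :: "nat \<Rightarrow> real"
      by (induction K) auto
    have "1 - 1 / (1 + real (m + K) * L) \<le> (\<Sum>k<m. a k / (real (m + K - 1 - k) * L + 1))
        + (\<Sum>i<K. a (m + i) / (real (m + K - 1 - (m + i)) * L + 1))"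
      using lower[of "m + K"] unfolding split .
    \<comment> \<open>For \<open>k < m\<close> each denominator is at least
      \<open>ln m * m * L\<close>, so these \<open>m\<close> terms contribute at most
      \<open>a 0 / (ln m * L)\<close>.\<close>
    also have "(\<Sum>k<m. a k / (real (m + K - 1 - k) * L + 1)) \<le> (\<Sum>k<m. a 0 / (ln m * m * L))"
    proof (rule sum_mono)
      fix k assume "k \<in> {..<m}"
      then have "real K \<le> real (m + K - 1 - k)" by auto
      then have "real K * L \<le> real (m + K - 1 - k) * L" using L by (intro mult_right_mono) auto
      moreover have "ln m * m * L \<le> K * L" using K L by (intro mult_right_mono) auto
      ultimately have "ln m * m * L \<le> real (m + K - 1 - k) * L + 1" by linarith
      then show "a k / (real (m + K - 1 - k) * L + 1) \<le> a 0 / (ln m * m * L)"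
        using a_le[of 0 k] nonneg mult_pos_pos[OF lnm L] by (intro frac_le) auto
    qed
    also have "(\<Sum>k<m. a 0 / (ln m * m * L)) = a 0 / (ln m * L)" using m by simp
    \<comment> \<open>From \<open>m\<close> on every value of \<open>a\<close> is at most
      \<open>a m\<close>, which leaves the kernel sum \<open>T K\<close>.\<close>
    also have "(\<Sum>i<K. a (m + i) / (real (m + K - 1 - (m + i)) * L + 1))
       \<le> (\<Sum>i<K. a m * (1 / (real (K - 1 - i) * L + 1)))"
    proof (rule sum_mono)
      fix i
      have "a (m + i) / (real (K - 1 - i) * L + 1) \<le> a m / (real (K - 1 - i) * L + 1)"
        using a_le by (intro divide_right_mono less_imp_le[OF pos]) auto
      then show "a (m + i) / (real (m + K - 1 - (m + i)) * L + 1) \<le> a m * (1 / (real (K - 1 - i) * L + 1))"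
        by simp
    qed
    also have "\<dots> = a m * T K"
      unfolding T_def sum_distrib_left[symmetric] by (subst rev) simp
    also have "T K \<le> 1 + ln ((ln m + 1) * m * L + 1) / L"
    proof -
      have "T K \<le> T (Suc K)" unfolding T_def using pos[of K] by simp
      also have "\<dots> \<le> 1 + ln (K * L + 1) / L"
        unfolding T_def by (rule sum_inverse_linear_bounds(2)[OF L])
      also have "ln (K * L + 1) \<le> ln ((ln m + 1) * m * L + 1)"
      proof -
        have "K * L + 1 \<le> (ln m + 1) * m * L + 1" using mult_right_mono[OF K(2), of L] L by simp
        then show ?thesis using pos[of K] less_le_trans[OF pos[of K]] by (subst ln_le_cancel_iff) auto
      qed
      finally show ?thesis using L by (simp add: divide_right_mono)
    qed
    finally have "1 - 1 / (1 + real (m + K) * L) \<le> a 0 / (ln m * L) + a m * (1 + ln ((ln m + 1) * m * L + 1) / L)"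
      using nonneg[of m] by (simp add: mult_left_mono)
    moreover have "1 / (1 + real (m + K) * L) \<le> 1 / (1 + m * L)"
      using L by (intro divide_left_mono mult_pos_pos) (auto intro!: add_pos_nonneg)
    ultimately have "1 - 1 / (1 + m * L) - a 0 / (ln m * L) \<le> a m * (1 + ln ((ln m + 1) * m * L + 1) / L)"
      by linarith
    moreover have D: "0 < 1 + ln ((ln m + 1) * m * L + 1) / L"
      using elim m L by (intro add_pos_nonneg divide_nonneg_pos) auto
    ultimately have "(1 - 1 / (1 + m * L) - a 0 / (ln m * L)) / (1 + ln ((ln m + 1) * m * L + 1) / L) \<le> a m"
      by (subst pos_divide_le_eq) auto
    from mult_left_mono[OF this, of "ln m"] elim show ?case by (simp add: mult.commute)
  qed
  have low_lim: "(\<lambda>m. (1 - 1 / (1 + real m * L) - a 0 / (ln m * L)) * ln m / (1 + ln ((ln m + 1) * m * L + 1) / L)) \<longlonglongrightarrow> L"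
    using L by real_asymp
  show ?thesis by (rule tendsto_sandwich[OF low up low_lim up_lim])
qed

lemma tendsto_ln_mult_shift:
  fixes b :: "nat \<Rightarrow> real"
  assumes "(\<lambda>n. ln n * b n) \<longlonglongrightarrow> c"
  shows "(\<lambda>n. ln n * b (Suc n)) \<longlonglongrightarrow> c"
proof -
  have "(\<lambda>n. ln (real n) / ln (real (Suc n))) \<longlonglongrightarrow> 1" by real_asymp
  from tendsto_mult[OF this LIMSEQ_Suc[OF assms]]
  have "(\<lambda>n. ln (real n) / ln (real (Suc n)) * (ln (real (Suc n)) * b (Suc n))) \<longlonglongrightarrow> c" by simp
  then show ?thesis
    by (rule Lim_transform_eventually) (intro eventually_sequentiallyI[of 1], auto)
qed

section \<open>The renewal equation of the operator\<close>

context hecke_seq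
begin

text \<open>\<open>Pop\<close> stripped of its parabolic branch \<open>al 0\<close>. For
  \<open>x\<close> in \<open>(0,1]\<close> the remaining branches take values in
  \<open>[inverse (1 + lam), 1)\<close>, so \<open>H u\<close> sees \<open>u\<close> away from
  \<open>0\<close> only.\<close>

definition H :: "(real \<Rightarrow> real) \<Rightarrow> real \<Rightarrow> real" where
  "H u x = pb 0 x * u (be 0 x)
     + (\<Sum>i<p - 1. pa (Suc i) x * u (al (Suc i) x) + pb (Suc i) x * u (be (Suc i) x))"

lemma Pop_eq_H: "Pop u x = pa 0 x * u (al 0 x) + H u x"
proof -
  obtain n where "p = Suc n" using p_pos by (cases p) auto
  then have "(\<Sum>j<p. f j) = f 0 + (\<Sum>i<p - 1. f (Suc i))" for f :: "nat \<Rightarrow> real"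
    by (simp add: sum.lessThan_Suc_shift del: sum.lessThan_Suc)
  then show ?thesis by (simp add: Pop_def H_def)
qed

lemma al_0: "al 0 x = x / (1 + lam * x)"
  by (simp add: al_def lam_eq add.commute)

lemma pa_0: "0 < x \<Longrightarrow> pa 0 x = 1 / (1 + lam * x)"
  by (simp add: pa_def lam_eq add.commute)

lemma pos_if_ge_inverse: "inverse (1 + lam) \<le> y \<Longrightarrow> 0 < y"
  using less_le_trans[of 0 "inverse (1 + lam)" y] lam_pos by simp

lemma H_mono:
  assumes "0 < x" "x \<le> 1" "\<And>y. inverse (1 + lam) \<le> y \<Longrightarrow> y < 1 \<Longrightarrow> u y \<le> v y"
  shows "H u x \<le> H v x"
  unfolding H_def using assms p_pos pa_pos pb_pos al_less_1 be_less_1 al_ge be_ge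
  by (intro sum_mono add_mono mult_left_mono) (auto simp: less_imp_le)

lemma H_cmult: "H (\<lambda>y. c * u y) x = c * H u x"
  by (simp add: H_def sum_distrib_left algebra_simps)

lemma H_const: assumes "0 < x" shows "H (\<lambda>_. c) x = c * (1 - pa 0 x)"
  using Pop_one[OF assms, of c] Pop_eq_H[of "\<lambda>_. c" x] by (simp add: algebra_simps)

text \<open>Away from \<open>0\<close> and for large \<open>j\<close>, the function
  \<open>phi j\<close> introduced below is close to \<open>inverse y / (j * lam)\<close>, hence
  \<open>H (phi j)\<close> is close to \<open>Psi / (j * lam)\<close>.\<close>

definition Psi :: "real \<Rightarrow> real" where
  "Psi = H inverse"

lemma Psi_eq:
  assumes "0 < x"
  shows "Psi x = x + (\<Sum>i<p - 1. x / (s (Suc (Suc i)) * x + s (Suc i))\<^sup>2 + x / (s (Suc i) * x + s (Suc (Suc i)))\<^sup>2)"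
proof -
  have "pb 0 x * inverse (be 0 x) = x"
    using lin_pos[OF p_pos assms] by (simp add: pb_def be_def)
  moreover have "pa j x * inverse (al j x) = x / (s (Suc j) * x + s j)\<^sup>2"
       "pb j x * inverse (be j x) = x / (s j * x + s (Suc j))\<^sup>2" if "j < p" for j
    using lin_pos[OF that assms] by (simp_all add: pa_def al_def pb_def be_def power2_eq_square add.commute)
  ultimately show ?thesis unfolding Psi_def H_def by (auto intro!: sum.cong)
qed

lemma Psi_nonneg: "0 < x \<Longrightarrow> 0 \<le> Psi x"
  by (auto simp: Psi_eq intro!: add_nonneg_nonneg sum_nonneg)

text \<open>Besides the term \<open>x\<close>, the summands come in pairs with opposite slopes at
  \<open>1\<close>. The slope \<open>1\<close> left over shows that \<open>Psi\<close> is largest at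
  \<open>1\<close>.\<close>

lemma has_tangent_Psi: assumes "0 < x0" "x0 \<le> 1" shows "\<exists>d. has_tangent Psi x0 d \<and> (x0 = 1 \<longrightarrow> d = 1)"
proof -
  define V where "V i x = x / (s (Suc (Suc i)) * x + s (Suc i))\<^sup>2 + x / (s (Suc i) * x + s (Suc (Suc i)))\<^sup>2" for i x
  define dV where "dV i = (s (Suc i) - s (Suc (Suc i)) * x0) / (s (Suc (Suc i)) * x0 + s (Suc i)) ^ 3
     + (s (Suc (Suc i)) - s (Suc i) * x0) / (s (Suc i) * x0 + s (Suc (Suc i))) ^ 3" for i
  have "has_tangent (V i) x0 (dV i)" if "i < p - 1" for i
    unfolding V_def dV_def
    using assms s_facts[of i] s_Suc_le_2[of i] s_le_Suc[of "Suc i"] less_le_trans[OF that diff_le_self] that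
    by (intro has_tangent_add has_tangent_square_denominator) auto
  moreover have "has_tangent (\<lambda>x. x) x0 1" by (simp add: has_tangent_def)
  ultimately have "has_tangent (\<lambda>x. x + (\<Sum>i<p - 1. V i x)) x0 (1 + (\<Sum>i<p - 1. dV i))"
    by (intro has_tangent_add has_tangent_sum) auto
  then have "has_tangent Psi x0 (1 + (\<Sum>i<p - 1. dV i))"
    by (rule has_tangent_cong[OF _ assms]) (simp add: Psi_eq V_def)
  moreover have "dV i = 0" if "x0 = 1" for i
    using that by (simp add: dV_def add.commute divide_simps)
  ultimately show ?thesis by (metis add.right_neutral sum.neutral)
qed

lemma Psi_le_at_1: assumes "0 < x" "x \<le> 1" shows "Psi x \<le> Psi 1"
  using has_tangent_Psi[of 1] has_tangentD[OF _ assms] assms by force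

lemma incr_concave_Psi: "incr_concave Psi"
proof (rule incr_concaveI)
  show "\<exists>d. has_tangent Psi y d" if "0 < y" "y < 1" for y
    using has_tangent_Psi[of y] that by auto
qed (use Psi_le_at_1 Psi_nonneg in auto)

lemma incr_concave_Popn_Psi: "incr_concave ((Pop ^^ n) Psi)"
  by (induction n) (auto simp: incr_concave_Psi incr_concave_Pop)

lemma Popn_Psi_le_at_1: assumes "0 < x" "x \<le> 1" shows "(Pop ^^ n) Psi x \<le> (Pop ^^ n) Psi 1"
  using assms Psi_le_at_1 Pop_le_at_1[OF incr_concave_Popn_Psi] by (cases n) auto

lemma Popn_Psi_mono: assumes "0 < y" "y \<le> x" "x \<le> 1" shows "(Pop ^^ n) Psi y \<le> (Pop ^^ n) Psi x"
proof (cases "x = 1")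
  case True
  then show ?thesis using assms Popn_Psi_le_at_1 by auto
next
  case False
  then show ?thesis using assms incr_concave_mono[OF incr_concave_Popn_Psi] by auto
qed

text \<open>\<open>Pop\<close> averages with total weight \<open>1\<close>, and every iterate of
  \<open>Psi\<close> is largest at \<open>1\<close>.\<close>

lemma Popn_Psi_at_1_decseq: "decseq (\<lambda>n. (Pop ^^ n) Psi 1)"
proof (rule decseq_SucI)
  fix n
  have "Pop ((Pop ^^ n) Psi) 1 \<le> Pop (\<lambda>_. (Pop ^^ n) Psi 1) 1"
    using Popn_Psi_le_at_1 by (intro Pop_mono) auto
  then show "(Pop ^^ Suc n) Psi 1 \<le> (Pop ^^ n) Psi 1" by (simp add: Pop_one)
qed

lemma Popn_Psi_nonneg: "0 < x \<Longrightarrow> x \<le> 1 \<Longrightarrow> 0 \<le> (Pop ^^ n) Psi x"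
  using Popn_nonneg Psi_nonneg by blast

text \<open>\<open>phi j x\<close> is the probability of making \<open>j\<close> steps along the parabolic branch
  \<^term>\<open>al 0\<close> when starting from \<open>x\<close>.\<close>

definition phi :: "nat \<Rightarrow> real \<Rightarrow> real" where
  "phi j x = 1 / (1 + j * lam * x)"

text \<open>A parabolic step lengthens the run:
  \<open>pa 0 x * phi j (al 0 x) = phi (Suc j) x\<close>.\<close>

lemma Pop_phi: assumes "0 < x" shows "Pop (phi j) x = phi (Suc j) x + H (phi j) x"
proof -
  have "0 < 1 + lam * x" "0 \<le> j * lam * x" using assms lam_pos by (auto intro: add_pos_pos)
  then have "0 < 1 + lam * x + j * lam * x" by linarith
  then have "pa 0 x * phi j (al 0 x) = phi (Suc j) x"
    using \<open>0 < 1 + lam * x\<close> assms by (simp add: pa_0 al_0 phi_def divide_simps) (simp add: algebra_simps)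
  then show ?thesis by (simp add: Pop_eq_H)
qed

text \<open>Last-exit decomposition for \<open>n\<close> free steps followed by \<open>j\<close>
  parabolic ones: in the term of index \<open>k\<close> the last step outside the parabolic branch
  is step \<open>k + 1\<close>, and \<open>phi (j + n)\<close> is the case without such a
  step.\<close>

lemma Popn_phi: assumes "0 < x" "x \<le> 1"
  shows "(Pop ^^ n) (phi j) x = phi (j + n) x + (\<Sum>k<n. (Pop ^^ k) (H (phi (j + n - 1 - k))) x)"
proof (induction n arbitrary: j)
  case (Suc n)
  have "(Pop ^^ Suc n) (phi j) x = (Pop ^^ n) (Pop (phi j)) x" by (simp only: Popn_Suc)
  also have "\<dots> = (Pop ^^ n) (\<lambda>x. phi (Suc j) x + H (phi j) x) x"
    using assms by (intro Popn_cong) (auto simp: Pop_phi)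
  also have "\<dots> = (Pop ^^ n) (phi (Suc j)) x + (Pop ^^ n) (H (phi j)) x"
    by (simp add: Popn_add)
  finally show ?case by (simp add: Suc.IH)
qed simp

text \<open>On \<open>[inverse (1 + lam), 1)\<close> the denominator \<open>1 + j * lam * y\<close>
  lies between \<open>(j * lam + 1) * y\<close> and \<open>(j * lam + 1 + lam) * y\<close>, and
  \<open>H\<close> sees no other points.\<close>

lemma H_phi_bounds: assumes "0 < x" "x \<le> 1"
  shows "Psi x / (j * lam + 1 + lam) \<le> H (phi j) x" "H (phi j) x \<le> Psi x / (j * lam + 1)"
proof -
  have pos: "0 < j * lam + 1" "0 < j * lam + 1 + lam" using lam_pos by (auto intro: add_nonneg_pos add_pos_pos)
  have *: "inverse (j * lam + 1 + lam) * inverse y \<le> phi j y \<and> phi j y \<le> inverse (j * lam + 1) * inverse y"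
    if "inverse (1 + lam) \<le> y" "y < 1" for y
  proof -
    have y: "0 < y" using that(1) by (rule pos_if_ge_inverse)
    have 1: "1 \<le> (1 + lam) * y" using that lam_pos by (simp add: field_simps)
    have "1 + j * lam * y \<le> (j * lam + 1 + lam) * y" "(j * lam + 1) * y \<le> 1 + j * lam * y"
      using 1 that by (simp_all add: algebra_simps)
    moreover have "0 < (j * lam + 1) * y" using pos y by simp
    moreover have "0 < 1 + j * lam * y" using y lam_pos by (auto intro: add_pos_nonneg)
    ultimately have "inverse ((j * lam + 1 + lam) * y) \<le> inverse (1 + j * lam * y)"
        "inverse (1 + j * lam * y) \<le> inverse ((j * lam + 1) * y)"
      by (blast intro: le_imp_inverse_le)+
    then show ?thesis by (simp add: phi_def inverse_mult_distrib flip: inverse_eq_divide)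
  qed
  have "inverse (j * lam + 1 + lam) * Psi x \<le> H (phi j) x" "H (phi j) x \<le> inverse (j * lam + 1) * Psi x"
    unfolding Psi_def H_cmult[symmetric] using assms * by (auto intro!: H_mono)
  then show "Psi x / (j * lam + 1 + lam) \<le> H (phi j) x" "H (phi j) x \<le> Psi x / (j * lam + 1)"
    by (simp_all add: divide_inverse mult.commute)
qed

text \<open>Decomposes the iterates of \<open>phi 0\<close>, which is constantly \<open>1\<close>;
  the first bound drops \<open>phi n x\<close>, the second keeps it.\<close>

lemma renewal_bounds:
  assumes "0 < x" "x \<le> 1"
  shows "(\<Sum>k<n. (Pop ^^ k) Psi x / (real (n - 1 - k) * lam + 1 + lam)) \<le> 1"
    and "1 - 1 / (1 + n * lam * x) \<le> (\<Sum>k<n. (Pop ^^ k) Psi x / (real (n - 1 - k) * lam + 1))"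
proof -
  have "(Pop ^^ n) (phi 0) x = (Pop ^^ n) (\<lambda>_. 1) x"
    using assms by (intro Popn_cong) (auto simp: phi_def)
  then have eq: "1 = phi n x + (\<Sum>k<n. (Pop ^^ k) (H (phi (n - 1 - k))) x)"
    using Popn_phi[OF assms, of n 0] Popn_const[OF assms] by simp
  have phi: "0 \<le> phi n x" using assms lam_pos by (auto simp: phi_def)
  have "(\<Sum>k<n. (Pop ^^ k) Psi x / (real (n - 1 - k) * lam + 1 + lam)) \<le> (\<Sum>k<n. (Pop ^^ k) (H (phi (n - 1 - k))) x)"
  proof (rule sum_mono)
    fix k
    define c where "c = inverse (real (n - 1 - k) * lam + 1 + lam)"
    have "(Pop ^^ k) (\<lambda>y. c * Psi y) x \<le> (Pop ^^ k) (H (phi (n - 1 - k))) x"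
      using assms H_phi_bounds(1) by (intro Popn_mono) (auto simp: c_def divide_inverse mult.commute)
    then show "(Pop ^^ k) Psi x / (real (n - 1 - k) * lam + 1 + lam) \<le> (Pop ^^ k) (H (phi (n - 1 - k))) x"
      unfolding Popn_cmult by (simp add: c_def divide_inverse mult.commute)
  qed
  then show "(\<Sum>k<n. (Pop ^^ k) Psi x / (real (n - 1 - k) * lam + 1 + lam)) \<le> 1" using eq phi by simp
  have "(\<Sum>k<n. (Pop ^^ k) (H (phi (n - 1 - k))) x) \<le> (\<Sum>k<n. (Pop ^^ k) Psi x / (real (n - 1 - k) * lam + 1))"
  proof (rule sum_mono)
    fix k
    define c where "c = inverse (real (n - 1 - k) * lam + 1)"
    have "(Pop ^^ k) (H (phi (n - 1 - k))) x \<le> (Pop ^^ k) (\<lambda>y. c * Psi y) x"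
      using assms H_phi_bounds(2) by (intro Popn_mono) (auto simp: c_def divide_inverse mult.commute)
    then show "(Pop ^^ k) (H (phi (n - 1 - k))) x \<le> (Pop ^^ k) Psi x / (real (n - 1 - k) * lam + 1)"
      unfolding Popn_cmult by (simp add: c_def divide_inverse mult.commute)
  qed
  then show "1 - 1 / (1 + n * lam * x) \<le> (\<Sum>k<n. (Pop ^^ k) Psi x / (real (n - 1 - k) * lam + 1))"
    using eq by (simp add: phi_def)
qed

lemma Popn_Psi_limit_at_1: "(\<lambda>n. ln n * (Pop ^^ n) Psi 1) \<longlonglongrightarrow> lam"
  using lam_pos Popn_Psi_at_1_decseq Popn_Psi_nonneg renewal_bounds[of 1]
  by (intro renewal_log_asymptotics) auto

text \<open>\<open>(Pop ^^ Suc n) Psi y\<close> averages the value at \<open>al 0 y\<close>, with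
  weight \<open>p0 > 0\<close>, and values at most that at \<open>1\<close>. The average and this
  upper bound have the same limit, so the value at \<open>al 0 y\<close> cannot lag behind.\<close>

lemma Popn_Psi_limit_step:
  assumes y: "0 < y" "y \<le> 1" and lim: "(\<lambda>n. ln n * (Pop ^^ n) Psi y) \<longlonglongrightarrow> lam"
  shows "(\<lambda>n. ln n * (Pop ^^ n) Psi (al 0 y)) \<longlonglongrightarrow> lam"
proof -
  define p0 where "p0 = pa 0 y"
  have p0: "0 < p0" using pa_pos p_pos y by (simp add: p0_def)
  have al: "0 < al 0 y" "al 0 y \<le> 1" using al_pos al_less_1 p_pos y by (auto simp: less_imp_le)
  have le1: "(Pop ^^ n) Psi (al 0 y) \<le> (Pop ^^ n) Psi 1" for n
    using Popn_Psi_le_at_1 al by blast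
  have up: "eventually (\<lambda>n. ln (real n) * (Pop ^^ n) Psi (al 0 y) \<le> ln (real n) * (Pop ^^ n) Psi 1) at_top"
    using le1 by (intro eventually_sequentiallyI[of 1] mult_left_mono) auto
  have step: "(Pop ^^ Suc n) Psi y \<le> p0 * (Pop ^^ n) Psi (al 0 y) + (1 - p0) * (Pop ^^ n) Psi 1" for n
  proof -
    have "H ((Pop ^^ n) Psi) y \<le> H (\<lambda>_. (Pop ^^ n) Psi 1) y"
      using y by (intro H_mono Popn_Psi_le_at_1) (auto intro: pos_if_ge_inverse)
    then show ?thesis using y by (simp add: Pop_eq_H H_const p0_def mult.commute)
  qed
  have low: "eventually (\<lambda>n. (ln n * (Pop ^^ Suc n) Psi y - (1 - p0) * (ln n * (Pop ^^ n) Psi 1)) / p0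
     \<le> ln n * (Pop ^^ n) Psi (al 0 y)) at_top"
  proof (rule eventually_sequentiallyI[of 1])
    fix n :: nat assume "1 \<le> n"
    then have "ln n * (Pop ^^ Suc n) Psi y \<le> ln n * (p0 * (Pop ^^ n) Psi (al 0 y) + (1 - p0) * (Pop ^^ n) Psi 1)"
      using step by (intro mult_left_mono) auto
    then have "ln n * (Pop ^^ Suc n) Psi y - (1 - p0) * (ln n * (Pop ^^ n) Psi 1) \<le> ln n * (Pop ^^ n) Psi (al 0 y) * p0"
      by (simp add: algebra_simps)
    then show "(ln n * (Pop ^^ Suc n) Psi y - (1 - p0) * (ln n * (Pop ^^ n) Psi 1)) / p0
       \<le> ln n * (Pop ^^ n) Psi (al 0 y)"
      using p0 by (subst pos_divide_le_eq)
  qed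
  have "(\<lambda>n. (ln n * (Pop ^^ Suc n) Psi y - (1 - p0) * (ln n * (Pop ^^ n) Psi 1)) / p0)
     \<longlonglongrightarrow> (lam - (1 - p0) * lam) / p0"
    using p0 by (intro tendsto_intros Popn_Psi_limit_at_1 tendsto_ln_mult_shift[OF lim]) auto
  then have "(\<lambda>n. (ln n * (Pop ^^ Suc n) Psi y - (1 - p0) * (ln n * (Pop ^^ n) Psi 1)) / p0) \<longlonglongrightarrow> lam"
    using p0 by (simp add: algebra_simps)
  from tendsto_sandwich[OF low up this Popn_Psi_limit_at_1] show ?thesis .
qed

lemma Popn_Psi_limit_parabolic: "(\<lambda>n. ln n * (Pop ^^ n) Psi (1 / (1 + real j * lam))) \<longlonglongrightarrow> lam"
proof (induction j)
  case 0
  then show ?case using Popn_Psi_limit_at_1 by simp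
next
  case (Suc j)
  have pos: "0 < 1 + real j * lam" "0 < 1 + real (Suc j) * lam"
    using lam_pos by (auto intro!: add_pos_nonneg)
  then have "al 0 (1 / (1 + real j * lam)) = 1 / (1 + real (Suc j) * lam)"
    by (simp add: al_0 divide_simps) (simp add: algebra_simps)
  then show ?case
    using Popn_Psi_limit_step[OF _ _ Suc.IH] pos lam_pos by simp
qed

text \<open>The orbit \<open>1 / (1 + j * lam)\<close> of \<open>1\<close> under \<open>al 0\<close>
  descends to \<open>0\<close>; monotonicity squeezes the value at \<open>x\<close> between those at
  an orbit point and at \<open>1\<close>.\<close>

lemma Popn_Psi_limit:
  assumes "0 < x" "x \<le> 1"
  shows "(\<lambda>n. ln n * (Pop ^^ n) Psi x) \<longlonglongrightarrow> lam"
proof -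
  obtain j :: nat where j: "1 / (lam * x) < real j" using reals_Archimedean2 by blast
  define y where "y = 1 / (1 + real j * lam)"
  have pos: "0 < 1 + real j * lam" using lam_pos by (auto intro!: add_pos_nonneg)
  have "1 < real j * (lam * x)" using j lam_pos assms by (simp add: pos_divide_less_eq)
  then have "1 \<le> x * (1 + real j * lam)" using assms by (simp add: algebra_simps)
  then have y: "0 < y" "y \<le> x" using pos by (auto simp: y_def pos_divide_le_eq)
  show ?thesis
  proof (rule tendsto_sandwich)
    show "eventually (\<lambda>n. ln (real n) * (Pop ^^ n) Psi y \<le> ln (real n) * (Pop ^^ n) Psi x) at_top"
      using Popn_Psi_mono[OF y assms(2)] by (intro eventually_sequentiallyI[of 1] mult_left_mono) auto
    show "eventually (\<lambda>n. ln (real n) * (Pop ^^ n) Psi x \<le> ln (real n) * (Pop ^^ n) Psi 1) at_top"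
      using Popn_Psi_le_at_1[OF assms] by (intro eventually_sequentiallyI[of 1] mult_left_mono) auto
    show "(\<lambda>n. ln (real n) * (Pop ^^ n) Psi y) \<longlonglongrightarrow> lam"
      unfolding y_def by (rule Popn_Psi_limit_parabolic)
  qed (rule Popn_Psi_limit_at_1)
qed

end

section \<open>Inverse square functions\<close>

lemma ln_nat_nonneg: "0 \<le> ln (real n)"
  \<comment> \<open>The case \<open>n = 0\<close> rests on the default value of \<open>ln\<close> at
    \<open>0\<close>.\<close>
  by (cases n) auto

text \<open>An epsilon form of a lower bound for the lower limit, so that bounds add, scale and pass
  to limits without extended reals.\<close>

definition liminf_ge :: "(nat \<Rightarrow> real) \<Rightarrow> real \<Rightarrow> bool" where
  "liminf_ge X c \<longleftrightarrow> (\<forall>e>0. \<forall>\<^sub>F n in sequentially. c - e \<le> X n)"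

lemma liminf_geD: "liminf_ge X c \<Longrightarrow> 0 < e \<Longrightarrow> \<forall>\<^sub>F n in sequentially. c - e \<le> X n"
  by (simp add: liminf_ge_def)

lemma liminf_ge_add:
  assumes "liminf_ge X a" "liminf_ge Y b"
  shows "liminf_ge (\<lambda>n. X n + Y n) (a + b)"
  unfolding liminf_ge_def
proof (intro allI impI)
  fix e :: real assume "0 < e"
  then have "\<forall>\<^sub>F n in sequentially. a - e/2 \<le> X n" "\<forall>\<^sub>F n in sequentially. b - e/2 \<le> Y n"
    using assms by (auto intro: liminf_geD)
  then show "\<forall>\<^sub>F n in sequentially. a + b - e \<le> X n + Y n"
    by eventually_elim linarith
qed

lemma liminf_ge_cmult:
  assumes "liminf_ge X a" "0 \<le> c"
  shows "liminf_ge (\<lambda>n. c * X n) (c * a)"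
proof (cases "c = 0")
  case False
  then have c: "0 < c" using assms by simp
  show ?thesis
    unfolding liminf_ge_def
  proof (intro allI impI)
    fix e :: real assume "0 < e"
    then have "\<forall>\<^sub>F n in sequentially. a - e / c \<le> X n"
      using assms c by (auto intro: liminf_geD)
    then show "\<forall>\<^sub>F n in sequentially. c * a - e \<le> c * X n"
    proof eventually_elim
      case (elim n)
      from mult_left_mono[OF this, of c] c show ?case by (simp add: algebra_simps)
    qed
  qed
qed (simp add: liminf_ge_def)

lemma liminf_ge_sum:
  assumes "\<And>i. i \<in> I \<Longrightarrow> liminf_ge (X i) (a i)"
  shows "liminf_ge (\<lambda>n. \<Sum>i\<in>I. X i n) (\<Sum>i\<in>I. a i)"
  using assms
proof (induction I rule: infinite_finite_induct)
  case (insert i I)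
  then show ?case using liminf_ge_add[of "X i" "a i" "\<lambda>n. \<Sum>i\<in>I. X i n"] by simp
qed (simp_all add: liminf_ge_def)

lemma liminf_ge_mono:
  assumes "liminf_ge X a" "\<forall>\<^sub>F n in sequentially. X n \<le> Y n"
  shows "liminf_ge Y a"
  unfolding liminf_ge_def
proof (intro allI impI)
  fix e :: real assume "0 < e"
  from liminf_geD[OF assms(1) this] assms(2) show "\<forall>\<^sub>F n in sequentially. a - e \<le> Y n"
    by eventually_elim linarith
qed

lemma liminf_ge_Suc: "liminf_ge (\<lambda>n. X (Suc n)) a \<Longrightarrow> liminf_ge X a"
  unfolding liminf_ge_def using eventually_sequentially_Suc[of "\<lambda>n. a - _ \<le> X n"] by blast

lemma liminf_ge_weaken: "liminf_ge X a \<Longrightarrow> b \<le> a \<Longrightarrow> liminf_ge X b"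
  unfolding liminf_ge_def by (blast intro: eventually_mono[of "\<lambda>n. a - _ \<le> X n"] order_trans[OF diff_right_mono])

lemma liminf_ge_limit:
  assumes "\<And>k. liminf_ge X (c k)" "c \<longlonglongrightarrow> a"
  shows "liminf_ge X a"
  unfolding liminf_ge_def
proof (intro allI impI)
  fix e :: real assume e: "0 < e"
  have "\<forall>\<^sub>F k in sequentially. a - e/2 < c k"
    using assms(2) e by (intro order_tendstoD) auto
  then obtain k where "a - e/2 < c k" by (auto simp: eventually_sequentially)
  moreover have "\<forall>\<^sub>F n in sequentially. c k - e/2 \<le> X n"
    using assms(1) e by (intro liminf_geD) auto
  ultimately show "\<forall>\<^sub>F n in sequentially. a - e \<le> X n"
    by (auto elim: eventually_mono)
qed

lemma liminf_ge_tendsto: assumes "X \<longlonglongrightarrow> a" shows "liminf_ge X a"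
  unfolding liminf_ge_def
proof (intro allI impI)
  fix e :: real assume e: "0 < e"
  have "\<forall>\<^sub>F k in sequentially. a - e < X k"
    using assms e by (intro order_tendstoD) auto
  then show "\<forall>\<^sub>F n in sequentially. a - e \<le> X n" by (auto elim: eventually_mono)
qed

lemma liminf_ge_0: "(\<And>n. 0 \<le> X n) \<Longrightarrow> liminf_ge X 0"
  by (auto simp: liminf_ge_def intro!: always_eventually intro: order_trans[of _ 0])

text \<open>No slack: \<open>X + Y\<close> tends to \<open>a + b\<close> while \<open>Y\<close> is
  asymptotically at least \<open>b\<close>, which bounds \<open>X\<close> from above.\<close>

lemma tendsto_of_liminf_ge:
  assumes "liminf_ge X a" "liminf_ge Y b" "(\<lambda>n. X n + Y n) \<longlonglongrightarrow> a + b"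
  shows "X \<longlonglongrightarrow> a"
proof (rule order_tendstoI)
  fix c assume "c < a"
  then have "\<forall>\<^sub>F n in sequentially. a - (a - c)/2 \<le> X n" by (intro liminf_geD[OF assms(1)]) auto
  then show "\<forall>\<^sub>F n in sequentially. c < X n"
    using \<open>c < a\<close> by (auto elim!: eventually_mono simp: field_simps)
next
  fix c assume "a < c"
  then have "\<forall>\<^sub>F n in sequentially. b - (c - a)/2 \<le> Y n" by (intro liminf_geD[OF assms(2)]) auto
  moreover have "\<forall>\<^sub>F n in sequentially. X n + Y n < a + b + (c - a)/2"
    using \<open>a < c\<close> by (intro order_tendstoD[OF assms(3)]) auto
  ultimately show "\<forall>\<^sub>F n in sequentially. X n < c"
    by eventually_elim (simp add: field_simps)
qed

text \<open>The functions \<^term>\<open>1 / (1 + t * y)\<^sup>2\<close>, \<^term>\<open>0 \<le> t\<close>, span a cone that is invariant under the transfer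
  operator and contains the derivatives of all inverse branches; \<open>G t\<close> is this function times \<open>y\<close>.\<close>

definition G :: "real \<Rightarrow> real \<Rightarrow> real" where
  "G t y = y / (1 + t * y)\<^sup>2"

lemma G_nonneg: "0 \<le> y \<Longrightarrow> 0 \<le> G t y"
  by (simp add: G_def)

lemma G_ratio: "0 < a \<Longrightarrow> inverse (a\<^sup>2) * G (b / a) y = y / (b * y + a)\<^sup>2"
proof -
  assume "0 < a"
  then have "1 + b / a * y = (b * y + a) / a" by (simp add: field_simps)
  then have "G (b / a) y = y / ((b * y + a) / a)\<^sup>2" by (simp only: G_def)
  then show ?thesis using \<open>0 < a\<close> by (simp add: power_divide)
qed

section \<open>The operator on inverse square functions\<close>

context hecke_seq
begin

text \<open>Up to the denominator of \<open>al j\<close>, \<open>1 + t * al j y\<close> is the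
  linear form \<open>X t (Suc j) * y + X t j\<close>; for \<open>be j\<close> the two coefficients
  swap.\<close>

definition X :: "real \<Rightarrow> nat \<Rightarrow> real" where
  "X t j = s (Suc j) + t * s j"

lemma X_pos: assumes "0 \<le> t" "j \<le> p" shows "0 < X t j"
proof -
  have "0 < s (Suc j)"
  proof (cases "j = p")
    case True
    then show ?thesis using s_pos[of "p - 1"] p_pos s_fold by simp
  qed (use s_pos assms in auto)
  then show ?thesis using s_nonneg assms by (auto simp: X_def intro!: add_pos_nonneg)
qed

lemma X_0: "X t 0 = 1" and X_1: "X t (Suc 0) = t + lam"
  by (simp_all add: X_def lam_eq)

definition G_pair :: "real \<Rightarrow> nat \<Rightarrow> real \<Rightarrow> real" where
  "G_pair t j y = inverse ((X t j)\<^sup>2) * G (X t (Suc j) / X t j) y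
     + inverse ((X t (Suc j))\<^sup>2) * G (X t j / X t (Suc j)) y"

lemma pa_G: assumes "j < p" "0 < y" "0 \<le> t"
  shows "pa j y * G t (al j y) = inverse ((X t j)\<^sup>2) * G (X t (Suc j) / X t j) y"
    and "pb j y * G t (be j y) = inverse ((X t (Suc j))\<^sup>2) * G (X t j / X t (Suc j)) y"
proof -
  have X: "0 < X t j" "0 < X t (Suc j)" using X_pos assms by auto
  have *: "y / (D * N) * G t (N / D) = y / (D + t * N)\<^sup>2" if "0 < N" "0 < D" for N D
  proof -
    have "0 < D + t * N" using that assms by (auto intro: add_pos_nonneg)
    moreover have "1 + t * (N / D) = (D + t * N) / D" using that by (simp add: field_simps)
    ultimately show ?thesis using that by (simp add: G_def power_divide power2_eq_square)
  qed
  show "pa j y * G t (al j y) = inverse ((X t j)\<^sup>2) * G (X t (Suc j) / X t j) y"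
    unfolding G_ratio[OF X(1)] unfolding pa_def al_def
    using lin_pos[OF assms(1,2)] by (subst *) (auto simp: X_def algebra_simps)
  show "pb j y * G t (be j y) = inverse ((X t (Suc j))\<^sup>2) * G (X t j / X t (Suc j)) y"
    unfolding G_ratio[OF X(2)] unfolding pb_def be_def
    using lin_pos[OF assms(1,2)] by (subst *) (auto simp: X_def algebra_simps)
qed

lemma H_G: assumes "0 < y" "0 \<le> t"
  shows "H (G t) y = inverse ((t + lam)\<^sup>2) * G (1 / (t + lam)) y + (\<Sum>i<p - 1. G_pair t (Suc i) y)"
  unfolding H_def using assms p_pos by (simp add: pa_G X_0 X_1 G_pair_def)

text \<open>Since \<open>X t 0 = 1\<close>, the parabolic branch merely shifts the parameter by
  \<open>lam\<close>.\<close>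

lemma Pop_G: assumes "0 < y" "0 \<le> t" shows "Pop (G t) y = G (t + lam) y + H (G t) y"
  using assms pa_G(1)[of 0 y t] p_pos by (simp add: Pop_eq_H X_0 X_1)

text \<open>The integral of \<open>G_pair t j y / y\<close> over \<open>[0,1]\<close>.\<close>

definition mass_pair :: "real \<Rightarrow> nat \<Rightarrow> real" where
  "mass_pair t j = inverse ((X t j)\<^sup>2) * (1 / (1 + X t (Suc j) / X t j))
     + inverse ((X t (Suc j))\<^sup>2) * (1 / (1 + X t j / X t (Suc j)))"

text \<open>Both summands combine to \<open>1 / (X t j * X t (Suc j))\<close>, and
  \<open>s (Suc j) * X t j - s j * X t (Suc j) = 1\<close> by \<open>s_det\<close>. The resulting
  form telescopes in \<open>j\<close>.\<close>

lemma mass_pair_eq: assumes "j < p" "0 \<le> t"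
  shows "mass_pair t j = s (Suc j) / X t (Suc j) - s j / X t j"
proof -
  have X: "0 < X t j" "0 < X t (Suc j)" using X_pos assms by auto
  have *: "inverse (a\<^sup>2) * (1 / (1 + b / a)) = 1 / (a * (a + b))" if "0 < a" "0 < b" for a b :: real
    using that by (simp add: field_simps power2_eq_square)
  have "mass_pair t j = 1 / (X t j * X t (Suc j))"
    unfolding mass_pair_def *[OF X] *[OF X(2,1)] using X
    by (simp add: divide_simps) (simp add: algebra_simps)
  also have "\<dots> = (s (Suc j) * X t j - s j * X t (Suc j)) / (X t j * X t (Suc j))"
    using s_det[of j] by (simp add: X_def algebra_simps)
  also have "\<dots> = s (Suc j) / X t (Suc j) - s j / X t j"
    using X by (simp add: diff_divide_distrib)
  finally show ?thesis .
qed

text \<open>Conservation of Lebesgue measure: the total mass \<open>1 / (1 + t)\<close> minus the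
  share of the parabolic branch. The end term of the telescoping sum is
  \<open>s p / X t p = 1 / (1 + t)\<close> by \<open>s_fold\<close>.\<close>

lemma mass_sum: assumes "0 \<le> t"
  shows "inverse ((t + lam)\<^sup>2) * (1 / (1 + 1 / (t + lam))) + (\<Sum>i<p - 1. mass_pair t (Suc i))
    = 1 / (1 + t) - 1 / (1 + (t + lam))"
proof -
  obtain n where n: "p = Suc n" using p_pos by (cases p) auto
  have "(\<Sum>i<p - 1. mass_pair t (Suc i)) = (\<Sum>i<n. s (Suc (Suc i)) / X t (Suc (Suc i)) - s (Suc i) / X t (Suc i))"
    using n assms by (auto simp: mass_pair_eq)
  also have "\<dots> = s p / X t p - s (Suc 0) / X t (Suc 0)"
    using sum_lessThan_telescope[of "\<lambda>i. s (Suc i) / X t (Suc i)" n] n by simp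
  also have "s p / X t p = 1 / (1 + t)"
    using X_pos[OF assms, of p] s_pos[of n] n assms by (simp add: X_def s_fold[unfolded n] divide_simps) (simp add: algebra_simps)
  finally have "(\<Sum>i<p - 1. mass_pair t (Suc i)) = 1 / (1 + t) - 1 / (t + lam)" by (simp add: X_1)
  moreover have "inverse (w\<^sup>2) * (1 / (1 + 1 / w)) = 1 / w - 1 / (1 + w)" if "0 < w" for w :: real
    using that by (simp add: field_simps power2_eq_square)
  ultimately show ?thesis using assms lam_pos by simp
qed

lemma Psi_G: assumes "0 < y" shows "Psi y = G 0 y + (\<Sum>i<p - 1. G_pair 0 i y)"
proof -
  have "G_pair 0 i y = y / (s (Suc (Suc i)) * y + s (Suc i))\<^sup>2 + y / (s (Suc i) * y + s (Suc (Suc i)))\<^sup>2"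
    if "i < p - 1" for i
    using that X_pos[of 0 i] X_pos[of 0 "Suc i"] by (simp add: G_pair_def G_ratio X_def)
  then show ?thesis using assms by (simp add: Psi_eq G_def)
qed

text \<open>The integral of \<open>Psi y / y\<close> over \<open>[0,1]\<close> equals the limit
  \<open>lam\<close> already known for \<open>Psi\<close>; this tightness turns lower bounds into
  limits later.\<close>

lemma Psi_mass: "1 + (\<Sum>i<p - 1. mass_pair 0 i) = lam"
proof -
  obtain n where n: "p = Suc n" using p_pos by (cases p) auto
  have "(\<Sum>i<p - 1. mass_pair 0 i) = (\<Sum>i<n. s (Suc i) / X 0 (Suc i) - s i / X 0 i)"
    using n by (auto simp: mass_pair_eq)
  also have "\<dots> = s n / s p"
    using sum_lessThan_telescope[of "\<lambda>i. s i / X 0 i" n] n by (simp add: X_def)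
  finally have "(\<Sum>i<p - 1. mass_pair 0 i) = s n / s p" .
  moreover have "lam * s p = s p + s n" using s_rec[of n] s_fold n by simp
  then have "lam = 1 + s n / s p" using s_pos[of n] n by (simp add: field_simps)
  ultimately show ?thesis by simp
qed

text \<open>Away from \<open>0\<close> one has \<open>1 + t * z \<le> (t + 1 + lam) * z\<close>,
  which compares \<open>G t\<close> with \<open>inverse\<close>.\<close>

lemma H_G_ge: assumes "0 < y" "y \<le> 1" "0 \<le> t" shows "inverse ((t + 1 + lam)\<^sup>2) * Psi y \<le> H (G t) y"
  unfolding Psi_def H_cmult[symmetric]
proof (rule H_mono[OF assms(1,2)])
  fix z assume z: "inverse (1 + lam) \<le> z" "z < 1"
  have z0: "0 < z" using z(1) by (rule pos_if_ge_inverse)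
  have "1 \<le> (1 + lam) * z" using z lam_pos by (simp add: field_simps)
  then have "1 + t * z \<le> (t + 1 + lam) * z" by (simp add: algebra_simps)
  then have "(1 + t * z)\<^sup>2 \<le> ((t + 1 + lam) * z)\<^sup>2"
    using z0 assms by (intro power_mono) auto
  moreover have "0 < 1 + t * z" using z0 assms by (auto intro: add_pos_nonneg)
  ultimately have "z / ((t + 1 + lam) * z)\<^sup>2 \<le> z / (1 + t * z)\<^sup>2"
    using z0 by (intro divide_left_mono mult_pos_pos) auto
  moreover have "z / ((t + 1 + lam) * z)\<^sup>2 = inverse ((t + 1 + lam)\<^sup>2) * inverse z"
    using z0 by (simp add: power_mult_distrib power2_eq_square divide_inverse)
  ultimately show "inverse ((t + 1 + lam)\<^sup>2) * inverse z \<le> G t z"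
    by (simp add: G_def)
qed

end

section \<open>Sharp lower bounds at a fixed base point\<close>

locale hecke_orbit = hecke_seq +
  fixes x :: real
  assumes x: "0 < x" "x \<le> 1"
begin

definition V :: "(real \<Rightarrow> real) \<Rightarrow> nat \<Rightarrow> real" where
  "V u n = ln n * (Pop ^^ n) u x"

lemma V_add: "V (\<lambda>y. u y + v y) n = V u n + V v n"
  by (simp add: V_def Popn_add distrib_left)

lemma V_cmult: "V (\<lambda>y. c * u y) n = c * V u n"
  by (simp add: V_def Popn_cmult)

lemma V_sum: "V (\<lambda>y. \<Sum>i\<in>I. u i y) n = (\<Sum>i\<in>I. V (u i) n)"
  by (simp add: V_def Popn_sum sum_distrib_left)

lemma V_cong: "(\<And>y. 0 < y \<Longrightarrow> y \<le> 1 \<Longrightarrow> u y = v y) \<Longrightarrow> V u n = V v n"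
  unfolding V_def using Popn_cong[OF x] by metis

lemma V_mono: "(\<And>y. 0 < y \<Longrightarrow> y \<le> 1 \<Longrightarrow> u y \<le> v y) \<Longrightarrow> V u n \<le> V v n"
  unfolding V_def by (intro mult_left_mono Popn_mono[OF x] ln_nat_nonneg) auto

lemma V_nonneg: "(\<And>y. 0 < y \<Longrightarrow> y \<le> 1 \<Longrightarrow> 0 \<le> u y) \<Longrightarrow> 0 \<le> V u n"
  unfolding V_def by (intro mult_nonneg_nonneg Popn_nonneg[OF x] ln_nat_nonneg) auto

lemma V_Psi: "V Psi \<longlonglongrightarrow> lam"
  unfolding V_def by (rule Popn_Psi_limit[OF x])

text \<open>As \<open>ln\<close> increases and the iterates are nonnegative, one application of
  \<open>Pop\<close> can be absorbed into the index.\<close>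

lemma liminf_V_Pop:
  assumes "liminf_ge (V (Pop u)) c" "\<And>y. 0 < y \<Longrightarrow> y \<le> 1 \<Longrightarrow> 0 \<le> u y"
  shows "liminf_ge (V u) c"
proof (rule liminf_ge_Suc, rule liminf_ge_mono[OF assms(1)], rule eventually_sequentiallyI[of 1])
  fix n :: nat assume n: "1 \<le> n"
  have "0 \<le> (Pop ^^ Suc n) u x" by (rule Popn_nonneg[OF x assms(2)])
  then show "V (Pop u) n \<le> V u (Suc n)"
    unfolding V_def Popn_Suc[symmetric] using n by (intro mult_right_mono) auto
qed

lemma liminf_G_step:
  assumes "0 \<le> t" "liminf_ge (V (G (t + lam))) a" "liminf_ge (V (H (G t))) b"
  shows "liminf_ge (V (G t)) (a + b)"
proof (rule liminf_V_Pop)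
  have "V (Pop (G t)) = (\<lambda>n. V (G (t + lam)) n + V (H (G t)) n)"
    unfolding V_add[symmetric] using assms by (intro ext V_cong Pop_G) auto
  then show "liminf_ge (V (Pop (G t))) (a + b)"
    using liminf_ge_add[OF assms(2,3)] by simp
qed (auto simp: G_nonneg)

text \<open>Each of \<open>J\<close> parabolic steps splits off a part at least
  \<open>inverse (c ^ 2) * Psi\<close>, whose limit under \<open>V\<close> dominates
  \<open>1 / c - 1 / (c + lam)\<close>. These differences telescope, and \<open>J\<close> tends to
  infinity.\<close>

lemma liminf_G_crude: assumes "0 \<le> t" shows "liminf_ge (V (G t)) (1 / (t + 1 + lam))"
proof (rule liminf_ge_limit)
  show "liminf_ge (V (G t)) (1 / (t + 1 + lam) - 1 / (t + 1 + lam + real J * lam))" for J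
    using assms
  proof (induction J arbitrary: t)
    case 0
    show ?case using liminf_ge_0[OF V_nonneg] by (simp add: G_nonneg)
  next
    case (Suc J)
    define c where "c = t + 1 + lam"
    have c: "0 < c" using Suc lam_pos by (simp add: c_def)
    have "liminf_ge (V (G (t + lam))) (1 / (c + lam) - 1 / (c + real (Suc J) * lam))"
      using Suc.IH[of "t + lam"] Suc.prems lam_pos by (simp add: c_def algebra_simps)
    moreover have "liminf_ge (V (H (G t))) (1 / c - 1 / (c + lam))"
    proof (rule liminf_ge_mono)
      have "liminf_ge (V Psi) lam" by (rule liminf_ge_tendsto[OF V_Psi])
      then have "liminf_ge (\<lambda>n. inverse (c\<^sup>2) * V Psi n) (inverse (c\<^sup>2) * lam)"
        by (intro liminf_ge_cmult) auto
      moreover have "1 / c - 1 / (c + lam) \<le> inverse (c\<^sup>2) * lam"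
      proof -
        have "1 / c - 1 / (c + lam) = lam / (c * (c + lam))" using c lam_pos by (simp add: field_simps)
        also have "\<dots> \<le> lam / (c * c)" using c lam_pos by (intro divide_left_mono mult_left_mono) auto
        finally show ?thesis by (simp add: field_simps power2_eq_square)
      qed
      ultimately show "liminf_ge (\<lambda>n. inverse (c\<^sup>2) * V Psi n) (1 / c - 1 / (c + lam))"
        by (rule liminf_ge_weaken)
      show "\<forall>\<^sub>F n in sequentially. inverse (c\<^sup>2) * V Psi n \<le> V (H (G t)) n"
        unfolding V_cmult[symmetric] c_def using Suc.prems
        by (intro always_eventually allI V_mono H_G_ge) auto
    qed
    ultimately have "liminf_ge (V (G t)) (1 / (c + lam) - 1 / (c + real (Suc J) * lam) + (1 / c - 1 / (c + lam)))"
      by (rule liminf_G_step[OF Suc.prems])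
    then show ?case by (simp add: c_def)
  qed
  show "(\<lambda>J. 1 / (t + 1 + lam) - 1 / (t + 1 + lam + real J * lam)) \<longlonglongrightarrow> 1 / (t + 1 + lam)"
    using lam_pos by real_asymp
qed

text \<open>The expected value of \<open>lim V (G t)\<close> is \<open>\<integral>\<^sub>0\<^sup>1 (1 + t y)\<^sup>-\<^sup>2 dy = 1 / (1 + t)\<close>.\<close>

definition G_liminf_ge :: "real \<Rightarrow> bool" where
  "G_liminf_ge e \<longleftrightarrow> (\<forall>t\<ge>0. liminf_ge (V (G t)) (e * (1 / (1 + t))))"

lemma G_liminf_geD: "G_liminf_ge e \<Longrightarrow> 0 \<le> t \<Longrightarrow> liminf_ge (V (G t)) (e * (1 / (1 + t)))"
  by (simp add: G_liminf_ge_def)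

lemma liminf_G_pair: assumes "G_liminf_ge e" "0 \<le> t" "j < p"
  shows "liminf_ge (V (G_pair t j)) (e * mass_pair t j)"
proof -
  have X: "0 < X t j" "0 < X t (Suc j)" using X_pos assms by auto
  have "liminf_ge (\<lambda>n. inverse ((X t j)\<^sup>2) * V (G (X t (Suc j) / X t j)) n
       + inverse ((X t (Suc j))\<^sup>2) * V (G (X t j / X t (Suc j))) n)
     (inverse ((X t j)\<^sup>2) * (e * (1 / (1 + X t (Suc j) / X t j)))
       + inverse ((X t (Suc j))\<^sup>2) * (e * (1 / (1 + X t j / X t (Suc j)))))"
    using X by (intro liminf_ge_add liminf_ge_cmult G_liminf_geD assms) auto
  moreover have "V (G_pair t j) = (\<lambda>n. inverse ((X t j)\<^sup>2) * V (G (X t (Suc j) / X t j)) n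
       + inverse ((X t (Suc j))\<^sup>2) * V (G (X t j / X t (Suc j))) n)"
    unfolding G_pair_def[abs_def] V_add V_cmult ..
  moreover have "inverse ((X t j)\<^sup>2) * (e * (1 / (1 + X t (Suc j) / X t j)))
       + inverse ((X t (Suc j))\<^sup>2) * (e * (1 / (1 + X t j / X t (Suc j)))) = e * mass_pair t j"
    unfolding mass_pair_def by (simp only: distrib_left mult.left_commute)
  ultimately show ?thesis by (simp only:)
qed

lemma V_H_G: assumes "0 \<le> t"
  shows "V (H (G t)) n = inverse ((t + lam)\<^sup>2) * V (G (1 / (t + lam))) n + (\<Sum>i<p - 1. V (G_pair t (Suc i)) n)"
  unfolding V_sum[symmetric] V_cmult[symmetric] V_add[symmetric] using assms by (intro V_cong H_G) auto

lemma liminf_H_G: assumes "G_liminf_ge e" "0 \<le> t"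
  shows "liminf_ge (V (H (G t))) (e * (1 / (1 + t) - 1 / (1 + (t + lam))))"
proof -
  have "liminf_ge (\<lambda>n. inverse ((t + lam)\<^sup>2) * V (G (1 / (t + lam))) n + (\<Sum>i<p - 1. V (G_pair t (Suc i)) n))
     (inverse ((t + lam)\<^sup>2) * (e * (1 / (1 + 1 / (t + lam)))) + (\<Sum>i<p - 1. e * mass_pair t (Suc i)))"
    using assms lam_pos by (intro liminf_ge_add liminf_ge_cmult liminf_ge_sum G_liminf_geD liminf_G_pair) auto
  then show ?thesis
    unfolding V_H_G[OF assms(2), symmetric] mass_sum[OF assms(2), symmetric]
    by (simp only: distrib_left mult.left_commute sum_distrib_left)
qed

lemma liminf_G_steps:
  assumes "G_liminf_ge e" "0 \<le> t" "liminf_ge (V (G (t + real N * lam))) c"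
  shows "liminf_ge (V (G t)) (c + e * (1 / (1 + t) - 1 / (1 + (t + real N * lam))))"
  using assms(2,3)
proof (induction N arbitrary: t)
  case (Suc N)
  have "liminf_ge (V (G (t + lam))) (c + e * (1 / (1 + (t + lam)) - 1 / (1 + (t + lam + real N * lam))))"
    using Suc lam_pos by (intro Suc.IH) (auto simp: algebra_simps)
  from liminf_G_step[OF Suc.prems(1) this liminf_H_G[OF assms(1) Suc.prems(1)]]
  show ?case by (simp add: algebra_simps)
qed simp

text \<open>Follow the parabolic branch \<open>N\<close> times and put
  \<open>D = 1 + N * lam\<close>. Parts leaving it keep the factor \<open>e\<close>; the rest obeys
  the crude bound, at least \<open>v = D / (D + lam)\<close> times the sharp value. The rest carries
  at least the fraction \<open>1 / D\<close> of the mass, so the gap \<open>v - e\<close> shrinks by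
  the factor \<open>1 - 1 / D\<close>.\<close>

lemma G_liminf_ge_improve:
  assumes e: "G_liminf_ge e" "e \<le> (1 + real N * lam) / (1 + real N * lam + lam)"
  shows "G_liminf_ge (e + (1 / (1 + real N * lam)) * ((1 + real N * lam) / (1 + real N * lam + lam) - e))"
  unfolding G_liminf_ge_def
proof (intro allI impI)
  fix t :: real assume t: "0 \<le> t"
  define D v where "D = 1 + real N * lam" and "v = (1 + real N * lam) / (1 + real N * lam + lam)"
  have D: "1 \<le> D" using lam_pos by (simp add: D_def)
  have "liminf_ge (V (G (t + real N * lam))) (1 / (t + real N * lam + 1 + lam))"
    using t lam_pos by (intro liminf_G_crude) auto
  from liminf_G_steps[OF e(1) t this]
  have *: "liminf_ge (V (G t)) (1 / (D + t + lam) + e * (1 / (1 + t) - 1 / (D + t)))"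
    by (simp add: D_def algebra_simps)
  have v1: "v * (1 / (D + t)) \<le> 1 / (D + t + lam)"
  proof -
    have "0 \<le> lam * t" using t lam_pos by simp
    then have "D * (D + t + lam) \<le> (D + lam) * (D + t)" by (simp add: algebra_simps)
    moreover have "0 < D + lam" "0 < D + t" "0 < D + t + lam" using D t lam_pos by auto
    ultimately show ?thesis unfolding v_def D_def[symmetric]
      by (simp add: pos_divide_le_eq pos_le_divide_eq mult.commute)
  qed
  have v2: "(v - e) * (1 / D * (1 / (1 + t))) \<le> (v - e) * (1 / (D + t))"
    using D t e(2) mult_right_mono[of 1 D t] unfolding v_def[symmetric]
    by (intro mult_left_mono) (auto simp: divide_simps algebra_simps)
  have "(e + C * (v - e)) * A \<le> E + e * (A - B)"
    if "v * B \<le> E" "(v - e) * (C * A) \<le> (v - e) * B" for A B C E :: real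
    using that by (simp add: algebra_simps)
  from this[OF v1 v2]
  have "(e + 1 / D * (v - e)) * (1 / (1 + t)) \<le> 1 / (D + t + lam) + e * (1 / (1 + t) - 1 / (D + t))" .
  from liminf_ge_weaken[OF * this]
  show "liminf_ge (V (G t)) ((e + (1 / (1 + real N * lam)) * ((1 + real N * lam) / (1 + real N * lam + lam) - e)) * (1 / (1 + t)))"
    by (simp add: D_def v_def)
qed

lemma G_liminf_ge_limit: assumes "\<And>k. G_liminf_ge (e k)" "e \<longlonglongrightarrow> c" shows "G_liminf_ge c"
  unfolding G_liminf_ge_def
proof (intro allI impI)
  fix t :: real assume "0 \<le> t"
  then have "liminf_ge (V (G t)) (e k * (1 / (1 + t)))" for k using assms(1) G_liminf_geD by auto
  moreover have "(\<lambda>k. e k * (1 / (1 + t))) \<longlonglongrightarrow> c * (1 / (1 + t))"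
    by (intro tendsto_intros assms(2))
  ultimately show "liminf_ge (V (G t)) (c * (1 / (1 + t)))" by (rule liminf_ge_limit)
qed

text \<open>For fixed \<open>N\<close>, iterating the improvement from the factor \<open>0\<close>
  converges geometrically to \<open>v\<close>; then \<open>v\<close> tends to \<open>1\<close> as
  \<open>N\<close> grows.\<close>

lemma G_liminf_ge_1: "G_liminf_ge 1"
proof (rule G_liminf_ge_limit)
  fix N :: nat
  define D v where "D = 1 + real N * lam" and "v = D / (D + lam)"
  have D: "1 \<le> D" using lam_pos by (simp add: D_def)
  have v: "0 \<le> v" using lam_pos D by (simp add: v_def)
  show "G_liminf_ge ((1 + real N * lam) / (1 + real N * lam + lam))"
    unfolding D_def[symmetric] v_def[symmetric]
  proof (rule G_liminf_ge_limit)
    show "G_liminf_ge (v - v * (1 - 1 / D) ^ k)" for k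
    proof (induction k)
      case 0
      show ?case using liminf_ge_0[OF V_nonneg] by (simp add: G_liminf_ge_def G_nonneg)
    next
      case (Suc k)
      have "0 \<le> v * (1 - 1 / D) ^ k" using v D by auto
      then have "G_liminf_ge (v - v * (1 - 1 / D) ^ k + 1 / D * (v - (v - v * (1 - 1 / D) ^ k)))"
        using G_liminf_ge_improve[OF Suc.IH, of N] unfolding v_def[symmetric] D_def[symmetric] by simp
      then show ?case by (simp add: algebra_simps)
    qed
    have "(\<lambda>k. v - v * (1 - 1 / D) ^ k) \<longlonglongrightarrow> v - v * 0"
      using D by (intro tendsto_intros LIMSEQ_realpow_zero) auto
    then show "(\<lambda>k. v - v * (1 - 1 / D) ^ k) \<longlonglongrightarrow> v" by simp
  qed
  show "(\<lambda>N. (1 + real N * lam) / (1 + real N * lam + lam)) \<longlonglongrightarrow> 1"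
    using lam_pos by real_asymp
qed

section \<open>From lower bounds to limits\<close>

lemma V_G_0: "V (G 0) \<longlonglongrightarrow> 1"
proof (rule tendsto_of_liminf_ge)
  show "liminf_ge (V (G 0)) 1" using G_liminf_geD[OF G_liminf_ge_1, of 0] by simp
  show "liminf_ge (\<lambda>n. \<Sum>i<p - 1. V (G_pair 0 i) n) (\<Sum>i<p - 1. mass_pair 0 i)"
    using liminf_G_pair[OF G_liminf_ge_1, of 0] by (intro liminf_ge_sum) auto
  \<comment> \<open>The lower bounds of the parts add up to the limit \<open>lam\<close> of
    \<open>V Psi\<close>, so none of them has slack.\<close>
  have "V Psi = (\<lambda>n. V (G 0) n + (\<Sum>i<p - 1. V (G_pair 0 i) n))"
    unfolding V_sum[symmetric] V_add[symmetric] by (intro ext V_cong Psi_G)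
  then show "(\<lambda>n. V (G 0) n + (\<Sum>i<p - 1. V (G_pair 0 i) n)) \<longlonglongrightarrow> 1 + (\<Sum>i<p - 1. mass_pair 0 i)"
    using V_Psi unfolding Psi_mass by (simp only:)
qed

text \<open>The limit of \<open>V (Pop (G t))\<close> is the sum of the lower bounds of its parts,
  so each part converges. The second claim repeats the argument inside
  \<open>H (G t)\<close>.\<close>

lemma V_G_step:
  assumes t: "0 \<le> t" and lim: "V (G t) \<longlonglongrightarrow> 1 / (1 + t)"
  shows "V (G (t + lam)) \<longlonglongrightarrow> 1 / (1 + (t + lam))"
    and "V (G (1 / (t + lam))) \<longlonglongrightarrow> 1 / (1 + 1 / (t + lam))"
proof -
  define c where "c = inverse ((t + lam)\<^sup>2)"
  have c: "0 < c" using t lam_pos by (simp add: c_def)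
  have "V (Pop (G t)) = (\<lambda>n. ln n * (Pop ^^ Suc n) (G t) x)"
    by (simp only: V_def[abs_def] Popn_Suc)
  then have "V (Pop (G t)) \<longlonglongrightarrow> 1 / (1 + t)"
    using tendsto_ln_mult_shift[of "\<lambda>n. (Pop ^^ n) (G t) x"] lim unfolding V_def[abs_def] by simp
  moreover have "V (Pop (G t)) = (\<lambda>n. V (G (t + lam)) n + V (H (G t)) n)"
    unfolding V_add[symmetric] using t by (intro ext V_cong Pop_G) auto
  ultimately have sum: "(\<lambda>n. V (G (t + lam)) n + V (H (G t)) n)
      \<longlonglongrightarrow> 1 / (1 + (t + lam)) + (1 / (1 + t) - 1 / (1 + (t + lam)))"
    by simp
  have l1: "liminf_ge (V (G (t + lam))) (1 / (1 + (t + lam)))"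
    using G_liminf_geD[OF G_liminf_ge_1, of "t + lam"] t lam_pos by simp
  have l2: "liminf_ge (V (H (G t))) (1 / (1 + t) - 1 / (1 + (t + lam)))"
    using liminf_H_G[OF G_liminf_ge_1 t] by simp
  show "V (G (t + lam)) \<longlonglongrightarrow> 1 / (1 + (t + lam))"
    by (rule tendsto_of_liminf_ge[OF l1 l2 sum])
  have "V (H (G t)) \<longlonglongrightarrow> 1 / (1 + t) - 1 / (1 + (t + lam))"
    using tendsto_of_liminf_ge[OF l2 l1] sum by (simp add: add.commute)
  then have sum2: "(\<lambda>n. c * V (G (1 / (t + lam))) n + (\<Sum>i<p - 1. V (G_pair t (Suc i)) n))
     \<longlonglongrightarrow> c * (1 / (1 + 1 / (t + lam))) + (\<Sum>i<p - 1. mass_pair t (Suc i))"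
    unfolding mass_sum[OF t, symmetric] c_def V_H_G[OF t, symmetric] .
  have "(\<lambda>n. c * V (G (1 / (t + lam))) n) \<longlonglongrightarrow> c * (1 / (1 + 1 / (t + lam)))"
  proof (rule tendsto_of_liminf_ge[OF _ _ sum2])
    show "liminf_ge (\<lambda>n. c * V (G (1 / (t + lam))) n) (c * (1 / (1 + 1 / (t + lam))))"
      using c t lam_pos G_liminf_geD[OF G_liminf_ge_1, of "1 / (t + lam)"] by (intro liminf_ge_cmult) auto
    show "liminf_ge (\<lambda>n. \<Sum>i<p - 1. V (G_pair t (Suc i)) n) (\<Sum>i<p - 1. mass_pair t (Suc i))"
      using liminf_G_pair[OF G_liminf_ge_1 t] by (intro liminf_ge_sum) auto
  qed
  from tendsto_mult_left[OF this, of "inverse c"] c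
  show "V (G (1 / (t + lam))) \<longlonglongrightarrow> 1 / (1 + 1 / (t + lam))"
    by (simp add: mult.assoc[symmetric])
qed

lemma V_G_multiple: "V (G (real N * lam)) \<longlonglongrightarrow> 1 / (1 + real N * lam)"
proof (induction N)
  case 0
  then show ?case using V_G_0 by simp
next
  case (Suc N)
  then show ?case using V_G_step(1)[of "real N * lam"] lam_pos by (simp add: algebra_simps)
qed

lemma V_G_inverse_multiple:
  "V (G (1 / (real (Suc N) * lam))) \<longlonglongrightarrow> 1 / (1 + 1 / (real (Suc N) * lam))"
  using V_G_step(2)[OF _ V_G_multiple[of N]] lam_pos by (simp add: algebra_simps)

end

section \<open>Equidistribution\<close>

text \<open>Multiplied by \<open>(1 + z) ^ 2\<close>, the partial sum collapses to
  \<open>1 - (- z) ^ n * (n + 1 + n * z)\<close>, which makes the error explicit.\<close>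

lemma inverse_square_expansion:
  fixes z :: real
  assumes "0 \<le> z"
  shows "\<bar>1 / (1 + z)\<^sup>2 - (\<Sum>i<n. (real i + 1) * (- z) ^ i)\<bar> \<le> (real n + 1) * z ^ n"
proof -
  have pos: "0 < 1 + z" using assms by simp
  have "(\<Sum>i<n. (real i + 1) * (- z) ^ i) * (1 + z)\<^sup>2 = 1 - (- z) ^ n * ((real n + 1) + n * z)"
    by (induction n) (simp_all add: algebra_simps power2_eq_square)
  then have "(\<Sum>i<n. (real i + 1) * (- z) ^ i) = (1 - (- z) ^ n * ((real n + 1) + n * z)) / (1 + z)\<^sup>2"
    using pos by (simp add: field_simps)
  then have "1 / (1 + z)\<^sup>2 - (\<Sum>i<n. (real i + 1) * (- z) ^ i) = (- z) ^ n * (((real n + 1) + n * z) / (1 + z)\<^sup>2)"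
    by (simp add: diff_divide_distrib)
  then have "\<bar>1 / (1 + z)\<^sup>2 - (\<Sum>i<n. (real i + 1) * (- z) ^ i)\<bar> = z ^ n * (((real n + 1) + n * z) / (1 + z)\<^sup>2)"
    using assms by (simp add: abs_mult power_abs)
  also have "\<dots> \<le> z ^ n * (real n + 1)"
  proof (rule mult_left_mono)
    have "(real n + 1) + n * z \<le> (real n + 1) * (1 + z)\<^sup>2"
      using assms by (simp add: algebra_simps power2_eq_square)
    then show "((real n + 1) + n * z) / (1 + z)\<^sup>2 \<le> real n + 1"
      using pos by (simp add: pos_divide_le_eq)
  qed (use assms in auto)
  finally show ?thesis by (simp add: mult.commute)
qed

lemma integral_inverse_square:
  fixes t :: real
  assumes "0 \<le> t"
  shows "integral {0..1} (\<lambda>y. 1 / (1 + t * y)\<^sup>2) = 1 / (1 + t)"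
proof -
  have nz: "1 + t * y \<noteq> 0" if "0 \<le> y" for y
    using assms that by (smt (verit) mult_nonneg_nonneg)
  have "((\<lambda>y. 1 / (1 + t * y)\<^sup>2) has_integral 1 / (1 + t * 1) - 0 / (1 + t * 0)) {0..1}"
  proof (rule fundamental_theorem_of_calculus)
    fix y :: real assume "y \<in> {0..1}"
    then have "((\<lambda>y. y / (1 + t * y)) has_real_derivative 1 / (1 + t * y)\<^sup>2) (at y within {0..1})"
      using nz[of y] by (auto intro!: derivative_eq_intros simp: power2_eq_square)
    then show "((\<lambda>y. y / (1 + t * y)) has_vector_derivative 1 / (1 + t * y)\<^sup>2) (at y within {0..1})"
      by (simp add: has_real_derivative_iff_has_vector_derivative)
  qed simp
  then show ?thesis by (auto intro!: integral_unique)
qed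

context hecke_orbit
begin

text \<open>The factor \<open>y\<close> undoes the conjugation by the density \<open>1 / y\<close>;
  continuity makes the integral additive.\<close>

definition equidistributed :: "(real \<Rightarrow> real) \<Rightarrow> bool" where
  "equidistributed f \<longleftrightarrow> continuous_on {0..1} f \<and> V (\<lambda>y. y * f y) \<longlonglongrightarrow> integral {0..1} f"

lemma equidistributed_add:
  assumes "equidistributed f" "equidistributed g"
  shows "equidistributed (\<lambda>y. f y + g y)"
proof -
  have "integral {0..1} (\<lambda>y. f y + g y) = integral {0..1} f + integral {0..1} g"
    using assms by (intro integral_add integrable_continuous_real) (auto simp: equidistributed_def)
  moreover have "V (\<lambda>y. y * (f y + g y)) = (\<lambda>n. V (\<lambda>y. y * f y) n + V (\<lambda>y. y * g y) n)"
    unfolding V_add[symmetric] by (simp add: distrib_left)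
  ultimately show ?thesis
    using assms by (auto simp: equidistributed_def intro!: tendsto_add continuous_intros)
qed

lemma equidistributed_cmult:
  assumes "equidistributed f"
  shows "equidistributed (\<lambda>y. c * f y)"
proof -
  have "V (\<lambda>y. y * (c * f y)) = (\<lambda>n. c * V (\<lambda>y. y * f y) n)"
    unfolding V_cmult[symmetric] by (simp add: mult.left_commute)
  then show ?thesis
    using assms by (auto simp: equidistributed_def intro!: tendsto_mult continuous_intros)
qed

lemma equidistributed_sum:
  assumes "\<And>i. i \<in> I \<Longrightarrow> equidistributed (f i)"
  shows "equidistributed (\<lambda>y. \<Sum>i\<in>I. f i y)"
proof -
  have "equidistributed (\<lambda>_. 0)"
    by (simp add: equidistributed_def V_def[abs_def] Popn_const[OF x])
  then show ?thesis using assms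
    by (induction I rule: infinite_finite_induct) (auto intro: equidistributed_add)
qed

lemma equidistributed_G:
  assumes "0 \<le> t" "V (G t) \<longlonglongrightarrow> 1 / (1 + t)"
  shows "equidistributed (\<lambda>y. 1 / (1 + t * y)\<^sup>2)"
proof -
  have "1 + t * y \<noteq> 0" if "0 \<le> y" for y
    using assms that by (smt (verit) mult_nonneg_nonneg)
  then have "continuous_on {0..1} (\<lambda>y. 1 / (1 + t * y)\<^sup>2)" by (auto intro!: continuous_intros)
  moreover have "(\<lambda>y. y * (1 / (1 + t * y)\<^sup>2)) = G t" by (auto simp: G_def)
  ultimately show ?thesis
    using assms integral_inverse_square by (simp add: equidistributed_def)
qed

text \<open>By positivity a uniform error \<open>e\<close> costs at most \<open>e * V (G 0)\<close>,
  and \<open>V (G 0)\<close> converges to \<open>1\<close>.\<close>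

lemma equidistributed_uniform_limit:
  assumes cont: "continuous_on {0..1} f"
    and approx: "\<And>e. 0 < e \<Longrightarrow> \<exists>g. equidistributed g \<and> (\<forall>y\<in>{0..1}. \<bar>f y - g y\<bar> \<le> e)"
  shows "equidistributed f"
proof -
  have "V (\<lambda>y. y * f y) \<longlonglongrightarrow> integral {0..1} f"
  proof (rule LIMSEQ_I)
    fix e :: real assume e: "0 < e"
    obtain g where g: "equidistributed g" "\<forall>y\<in>{0..1}. \<bar>f y - g y\<bar> \<le> e / 5"
      using approx[of "e / 5"] e by auto
    have "\<bar>integral {0..1} f - integral {0..1} g\<bar> = norm (integral {0..1} (\<lambda>y. f y - g y))"
      using cont g(1) by (subst integral_diff) (auto simp: equidistributed_def intro!: integrable_continuous_real)
    also have "\<dots> \<le> e / 5 * (1 - 0)"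
      using g cont by (intro integral_bound) (auto simp: equidistributed_def intro!: continuous_intros)
    finally have I: "\<bar>integral {0..1} f - integral {0..1} g\<bar> \<le> e / 5" by simp
    have bound: "\<bar>V (\<lambda>y. y * f y) n - V (\<lambda>y. y * g y) n\<bar> \<le> e / 5 * V (G 0) n" for n
    proof -
      have *: "y * f y \<le> y * g y + e / 5 * G 0 y" "y * g y \<le> y * f y + e / 5 * G 0 y"
        if "0 < y" "y \<le> 1" for y
      proof -
        have "f y \<le> g y + e / 5" "g y \<le> f y + e / 5" using bspec[OF g(2), of y] that unfolding abs_le_iff by auto
        then have "y * f y \<le> y * (g y + e / 5)" "y * g y \<le> y * (f y + e / 5)"
          using that by (auto intro!: mult_left_mono)
        then show "y * f y \<le> y * g y + e / 5 * G 0 y" "y * g y \<le> y * f y + e / 5 * G 0 y"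
          by (simp_all add: G_def algebra_simps)
      qed
      have "V (\<lambda>y. y * f y) n \<le> V (\<lambda>y. y * g y + e / 5 * G 0 y) n"
           "V (\<lambda>y. y * g y) n \<le> V (\<lambda>y. y * f y + e / 5 * G 0 y) n"
        using * by (auto intro!: V_mono)
      then show ?thesis unfolding V_add V_cmult by linarith
    qed
    \<comment> \<open>The errors are \<open>e / 5\<close> from the integrals,
      \<open>2 * e / 5\<close> from the approximation and \<open>e / 5\<close> from convergence,
      together below \<open>e\<close>.\<close>
    have "\<forall>\<^sub>F n in sequentially. V (G 0) n < 2"
      by (intro order_tendstoD[OF V_G_0]) auto
    moreover have "\<forall>\<^sub>F n in sequentially. dist (V (\<lambda>y. y * g y) n) (integral {0..1} g) < e / 5"
      using g(1) e by (intro tendstoD) (auto simp: equidistributed_def)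
    ultimately have "\<forall>\<^sub>F n in sequentially. norm (V (\<lambda>y. y * f y) n - integral {0..1} f) < e"
    proof eventually_elim
      case (elim n)
      have "e / 5 * V (G 0) n \<le> e / 5 * 2" using elim e by (intro mult_left_mono) auto
      then show ?case using elim I bound[of n] e unfolding dist_real_def real_norm_def by linarith
    qed
    then show "\<exists>no. \<forall>n\<ge>no. norm (V (\<lambda>y. y * f y) n - integral {0..1} f) < e"
      by (simp add: eventually_sequentially)
  qed
  then show ?thesis using cont by (simp add: equidistributed_def)
qed

text \<open>The coefficient of \<open>t\<^sup>k\<close> in \<open>1 / (1 + t * y)\<^sup>2\<close> is a multiple of \<open>y\<^sup>k\<close>; it is
  extracted by letting \<open>t = 1 / (Suc N * lam)\<close> tend to \<open>0\<close>.\<close>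

lemma equidistributed_power: "equidistributed (\<lambda>y. y ^ k)"
proof (induction k rule: less_induct)
  case (less k)
  show ?case
  proof (rule equidistributed_uniform_limit)
    fix e :: real assume e: "0 < e"
    \<comment> \<open>Ensures \<open>2 * t \<le> e\<close>, where \<open>2 * t\<close> will bound
      the distance of \<open>g\<close> from the monomial.\<close>
    obtain N :: nat where "2 / (lam * e) < real N" using reals_Archimedean2 by blast
    define t where "t = 1 / (real (Suc N) * lam)"
    have t: "0 < t" using lam_pos by (simp add: t_def)
    have "2 < real N * (lam * e)" using \<open>2 / (lam * e) < real N\<close> lam_pos e by (simp add: pos_divide_less_eq)
    then have "2 < e * (real (Suc N) * lam)" using mult_pos_pos[OF e lam_pos] by (simp add: algebra_simps)
    then have te: "2 * t \<le> e" using lam_pos by (simp add: t_def pos_divide_le_eq)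
    \<comment> \<open>Normalizes the coefficient \<open>(k + 1) * (- t) ^ k\<close> of
      \<open>y ^ k\<close> to \<open>1\<close>; in \<open>g\<close> the lower powers are removed,
      which the induction hypothesis covers.\<close>
    define c where "c = (- 1) ^ k / ((real k + 1) * t ^ k)"
    define g where "g y = c * (1 / (1 + t * y)\<^sup>2 + (\<Sum>i<k. (- ((real i + 1) * (- t) ^ i)) * y ^ i))" for y
    have "equidistributed g"
      unfolding g_def[abs_def] using less t V_G_inverse_multiple[of N]
      by (intro equidistributed_cmult equidistributed_add equidistributed_sum equidistributed_G)
         (auto simp: t_def)
    moreover have "\<bar>y ^ k - g y\<bar> \<le> e" if y: "y \<in> {0..1}" for y
    proof -
      have c: "c * ((real k + 1) * (- (t * y)) ^ k) = y ^ k"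
        using t by (simp add: c_def power_minus[of "t * y"] power_mult_distrib)
      have "g y = c * (1 / (1 + t * y)\<^sup>2 - (\<Sum>i<k. (real i + 1) * (- (t * y)) ^ i))"
        by (simp add: g_def sum_negf power_mult_distrib[symmetric] mult.assoc)
      also have "\<dots> = c * (1 / (1 + t * y)\<^sup>2 - (\<Sum>i<Suc k. (real i + 1) * (- (t * y)) ^ i)) + y ^ k"
        by (simp add: c[symmetric] algebra_simps)
      finally have "\<bar>y ^ k - g y\<bar> = \<bar>c\<bar> * \<bar>1 / (1 + t * y)\<^sup>2 - (\<Sum>i<Suc k. (real i + 1) * (- (t * y)) ^ i)\<bar>"
        by (simp add: abs_mult)
      also have "\<dots> \<le> \<bar>c\<bar> * ((real (Suc k) + 1) * (t * y) ^ Suc k)"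
        using t y by (intro mult_left_mono inverse_square_expansion) auto
      also have "\<dots> \<le> \<bar>c\<bar> * ((2 * (real k + 1)) * t ^ Suc k)"
        using t y by (intro mult_left_mono mult_mono power_mono) (auto simp: mult_left_le)
      also have "\<dots> = 2 * t"
      proof -
        have "1 / (a * b) * ((2 * a) * (t * b)) = 2 * t" if "a \<noteq> 0" "b \<noteq> 0" for a b :: real
          using that by (simp add: field_simps)
        from this[of "real k + 1" "t ^ k"] show ?thesis
          using t by (simp add: c_def abs_mult power_abs)
      qed
      finally show ?thesis using te by simp
    qed
    ultimately show "\<exists>g. equidistributed g \<and> (\<forall>y\<in>{0..1}. \<bar>y ^ k - g y\<bar> \<le> e)" by blast
  qed (intro continuous_intros)
qed

theorem equidistribution:
  assumes "continuous_on {0..1} f"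
  shows "V (\<lambda>y. y * f y) \<longlonglongrightarrow> integral {0..1} f"
proof -
  have "equidistributed f"
  proof (rule equidistributed_uniform_limit[OF assms])
    fix e :: real assume "0 < e"
    obtain g where g: "real_polynomial_function g" "\<And>y. y \<in> {0..1} \<Longrightarrow> \<bar>f y - g y\<bar> < e"
      using Stone_Weierstrass_real_polynomial_function[OF compact_Icc assms \<open>0 < e\<close>] by blast
    from g(1) obtain a n where "g = (\<lambda>y. \<Sum>i\<le>n. a i * y ^ i)"
      unfolding real_polynomial_function_iff_sum by blast
    then have "equidistributed g"
      using equidistributed_power by (auto intro!: equidistributed_sum equidistributed_cmult)
    then show "\<exists>g. equidistributed g \<and> (\<forall>y\<in>{0..1}. \<bar>f y - g y\<bar> \<le> e)"
      using g(2) less_imp_le by blast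
  qed
  then show ?thesis by (simp add: equidistributed_def)
qed

end

section \<open>Words\<close>

lemma mk2_nth [simp]: "mk2 a b c d $ 1 $ 1 = a" "mk2 a b c d $ 1 $ 2 = b"
  "mk2 a b c d $ 2 $ 1 = c" "mk2 a b c d $ 2 $ 2 = d"
  by (simp_all add: mk2_def)

lemma mk2_mult:
  "mk2 a b c d ** mk2 a' b' c' d' = mk2 (a * a' + b * c') (a * b' + b * d') (c * a' + d * c') (c * b' + d * d')"
  by (simp add: vec_eq_iff forall_2 matrix_matrix_mult_def sum_2)

lemma mat_1_mk2: "mat 1 = mk2 1 0 0 1"
  by (simp add: vec_eq_iff forall_2 mat_def)

lemma matrix_inv_eqI:
  fixes A B :: "'a::semiring_1^'n^'n"
  assumes "A ** B = mat 1" "B ** A = mat 1"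
  shows "matrix_inv A = B"
proof -
  have "A ** matrix_inv A = mat 1 \<and> matrix_inv A ** A = mat 1"
    unfolding matrix_inv_def by (rule someI[of _ B]) (use assms in auto)
  then have "matrix_inv A ** (A ** B) = B"
    by (simp add: matrix_mul_assoc)
  then show ?thesis by (simp add: assms)
qed

text \<open>Nonnegative entries keep the positive axis free of poles; the absolute value admits
  determinant \<open>-1\<close>, which the factor \<open>Qmat\<close> produces.\<close>

definition nonneg_mat :: "mat2 \<Rightarrow> bool" where
  "nonneg_mat M \<longleftrightarrow> (\<exists>a b c d. M = mk2 a b c d \<and> 0 \<le> a \<and> 0 \<le> b \<and> 0 \<le> c \<and> 0 \<le> d \<and> \<bar>a * d - b * c\<bar> = 1)"

lemma nonneg_matI:
  "0 \<le> a \<Longrightarrow> 0 \<le> b \<Longrightarrow> 0 \<le> c \<Longrightarrow> 0 \<le> d \<Longrightarrow> \<bar>a * d - b * c\<bar> = 1 \<Longrightarrow> nonneg_mat (mk2 a b c d)"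
  unfolding nonneg_mat_def by blast

lemma nonneg_mat_mult: assumes "nonneg_mat A" "nonneg_mat B" shows "nonneg_mat (A ** B)"
proof -
  obtain a b c d where A: "A = mk2 a b c d" "0 \<le> a" "0 \<le> b" "0 \<le> c" "0 \<le> d" "\<bar>a * d - b * c\<bar> = 1"
    using assms unfolding nonneg_mat_def by blast
  obtain a' b' c' d' where B: "B = mk2 a' b' c' d'" "0 \<le> a'" "0 \<le> b'" "0 \<le> c'" "0 \<le> d'" "\<bar>a' * d' - b' * c'\<bar> = 1"
    using assms unfolding nonneg_mat_def by blast
  have "(a * a' + b * c') * (c * b' + d * d') - (a * b' + b * d') * (c * a' + d * c')
      = (a * d - b * c) * (a' * d' - b' * c')" by (simp add: algebra_simps)
  then have "\<bar>(a * a' + b * c') * (c * b' + d * d') - (a * b' + b * d') * (c * a' + d * c')\<bar> = 1"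
    using A B by (simp add: abs_mult)
  then show ?thesis unfolding A(1) B(1) mk2_mult
    using A(2-5) B(2-5) by (intro nonneg_matI add_nonneg_nonneg mult_nonneg_nonneg)
qed

lemma nonneg_mat_1: "nonneg_mat (mat 1)"
  unfolding mat_1_mk2 by (rule nonneg_matI) auto

lemma lin_pos_of_det:
  fixes a b c d x :: real
  assumes "0 \<le> a" "0 \<le> b" "0 \<le> c" "0 \<le> d" "\<bar>a * d - b * c\<bar> = 1" "0 < x"
  shows "0 < a * x + b" "0 < c * x + d"
proof -
  have "0 < a \<or> 0 < b" "0 < c \<or> 0 < d" using assms(1-5) by (auto simp: less_le)
  then show "0 < a * x + b" "0 < c * x + d"
    using assms by (auto intro: add_nonneg_pos add_pos_nonneg)
qed

lemma mob_mk2: "mob (mk2 a b c d) x = (a * x + b) / (c * x + d)"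
  by (simp add: mob_def)

lemma mob_mat_1: "mob (mat 1) x = x"
  by (simp add: mat_1_mk2 mob_mk2)

lemma mob_pos: assumes "nonneg_mat M" "0 < x" shows "0 < mob M x"
  using assms lin_pos_of_det unfolding nonneg_mat_def by (auto simp: mob_mk2 intro!: divide_pos_pos)

text \<open>The absolute derivative of \<open>mob M\<close> in the coordinate \<open>ln x\<close>,
  hence multiplicative under composition.\<close>

definition weight :: "mat2 \<Rightarrow> real \<Rightarrow> real" where
  "weight M x = x * \<bar>deriv (mob M) x\<bar> / mob M x"

lemma weight_mk2:
  assumes "0 \<le> a" "0 \<le> b" "0 \<le> c" "0 \<le> d" "\<bar>a * d - b * c\<bar> = 1" "0 < x"
  shows "weight (mk2 a b c d) x = x / ((c * x + d) * (a * x + b))"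
proof -
  note pos = lin_pos_of_det[OF assms]
  have "((\<lambda>x. (a * x + b) / (c * x + d)) has_real_derivative (a * d - b * c) / (c * x + d)\<^sup>2) (at x)"
    using pos by (auto intro!: derivative_eq_intros simp: power2_eq_square) (simp add: algebra_simps)
  then have "deriv (mob (mk2 a b c d)) x = (a * d - b * c) / (c * x + d)\<^sup>2"
    unfolding mob_mk2[abs_def] by (rule DERIV_imp_deriv)
  then have "\<bar>deriv (mob (mk2 a b c d)) x\<bar> = 1 / (c * x + d)\<^sup>2"
    using assms(5) by (simp add: abs_divide)
  then show ?thesis using pos by (simp add: weight_def mob_mk2 power2_eq_square)
qed

lemma mob_mult:
  assumes "nonneg_mat A" "nonneg_mat M" "0 < x"
  shows "mob (A ** M) x = mob A (mob M x)" and "weight (A ** M) x = weight M x * weight A (mob M x)"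
proof -
  obtain a b c d where A: "A = mk2 a b c d" "0 \<le> a" "0 \<le> b" "0 \<le> c" "0 \<le> d" "\<bar>a * d - b * c\<bar> = 1"
    using assms unfolding nonneg_mat_def by blast
  obtain a' b' c' d' where M: "M = mk2 a' b' c' d'" "0 \<le> a'" "0 \<le> b'" "0 \<le> c'" "0 \<le> d'" "\<bar>a' * d' - b' * c'\<bar> = 1"
    using assms unfolding nonneg_mat_def by blast
  define N D where "N = a' * x + b'" and "D = c' * x + d'"
  have ND: "0 < N" "0 < D" using lin_pos_of_det[OF M(2-6) assms(3)] by (auto simp: N_def D_def)
  define y where "y = N / D"
  have y: "0 < y" "mob M x = y" using ND by (auto simp: y_def M(1) mob_mk2 N_def D_def)
  note pos = lin_pos_of_det[OF A(2-6) y(1)]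
  \<comment> \<open>The linear forms of the product are those of \<open>A\<close> at
    \<open>y = N / D\<close>, scaled by \<open>D\<close>.\<close>
  have lin: "(a * a' + b * c') * x + (a * b' + b * d') = (a * y + b) * D"
    "(c * a' + d * c') * x + (c * b' + d * d') = (c * y + d) * D"
    using ND by (simp_all add: y_def field_simps) (simp_all add: N_def D_def algebra_simps)
  show "mob (A ** M) x = mob A (mob M x)"
    unfolding y(2) unfolding A(1) M(1) mk2_mult mob_mk2 lin using ND by simp
  obtain a'' b'' c'' d'' where AM: "A ** M = mk2 a'' b'' c'' d''" "0 \<le> a''" "0 \<le> b''" "0 \<le> c''" "0 \<le> d''"
      "\<bar>a'' * d'' - b'' * c''\<bar> = 1"
    using nonneg_mat_mult[OF assms(1,2)] unfolding nonneg_mat_def by blast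
  have AM_eq: "a'' = a * a' + b * c'" "b'' = a * b' + b * d'" "c'' = c * a' + d * c'" "d'' = c * b' + d * d'"
    using AM(1) unfolding A(1) M(1) mk2_mult by (metis mk2_nth)+
  have "weight (A ** M) x = x / (((c * y + d) * D) * ((a * y + b) * D))"
    unfolding AM(1) weight_mk2[OF AM(2-6) assms(3)] unfolding AM_eq lin ..
  moreover have "weight A y = y / ((c * y + d) * (a * y + b))"
    unfolding A(1) by (rule weight_mk2[OF A(2-6) y(1)])
  moreover have "weight M x = x / (D * N)"
    unfolding M(1) N_def D_def by (rule weight_mk2[OF M(2-6) assms(3)])
  ultimately show "weight (A ** M) x = weight M x * weight A (mob M x)"
    using ND pos unfolding y(2) by (simp add: y_def)
qed

lemma mob_inj:
  assumes "nonneg_mat M" "0 < x" "0 < y" "mob M x = mob M y"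
  shows "x = y"
proof -
  obtain a b c d where M: "M = mk2 a b c d" "0 \<le> a" "0 \<le> b" "0 \<le> c" "0 \<le> d" "\<bar>a * d - b * c\<bar> = 1"
    using assms unfolding nonneg_mat_def by blast
  have "(a * x + b) * (c * y + d) = (a * y + b) * (c * x + d)"
    using assms(4) lin_pos_of_det[OF M(2-6) assms(2)] lin_pos_of_det[OF M(2-6) assms(3)]
    unfolding M(1) mob_mk2 by (simp add: frac_eq_eq)
  then have "(a * d - b * c) * (x - y) = 0" by (simp add: algebra_simps)
  then show ?thesis using M(6) by auto
qed

lemma frac_less_of_cross: "0 < b \<Longrightarrow> 0 < d \<Longrightarrow> a * d < c * b \<Longrightarrow> a / b < c / d" for a b c d :: real
  by (simp add: pos_divide_less_eq pos_less_divide_eq)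

section \<open>Coding of the semigroup by words\<close>

context hecke_seq
begin

text \<open>\<open>True\<close> selects \<open>al j\<close> with determinant \<open>1\<close>,
  \<open>False\<close> selects \<open>be j\<close> with determinant \<open>-1\<close>.\<close>

definition letter :: "nat \<times> bool \<Rightarrow> mat2" where
  "letter i = (case i of (j, c) \<Rightarrow> if c then mk2 (s (Suc j)) (s j) (s (Suc (Suc j))) (s (Suc j))
     else mk2 (s j) (s (Suc j)) (s (Suc j)) (s (Suc (Suc j))))"

definition ind :: "(nat \<times> bool) set" where
  "ind = {..<p} \<times> UNIV"

lemma nonneg_letter: "i \<in> ind \<Longrightarrow> nonneg_mat (letter i)"
  using s_facts[of "fst i"]
  by (auto simp: ind_def letter_def s_det less_imp_le intro!: nonneg_matI)

lemma mob_letter: "mob (letter (j, c)) x = (if c then al j x else be j x)"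
  by (auto simp: letter_def mob_mk2 al_def be_def add.commute)

lemma weight_letter: assumes "j < p" "0 < x" shows "weight (letter (j, c)) x = (if c then pa j x else pb j x)"
  using assms s_facts[of j]
  by (auto simp: letter_def weight_mk2 s_det pa_def pb_def add.commute mult.commute less_imp_le)

lemma sum_ind: "(\<Sum>i\<in>ind. g i) = (\<Sum>j<p. g (j, True) + g (j, False))"
  unfolding ind_def using sum.cartesian_product[of "\<lambda>j b. g (j, b)" UNIV "{..<p}"]
  by (simp add: UNIV_bool add.commute)

lemma sum_letters: assumes "0 < x"
  shows "(\<Sum>i\<in>ind. weight (letter i) x * u (mob (letter i) x)) = Pop u x"
  unfolding sum_ind Pop_def using assms by (simp add: mob_letter weight_letter)

lemma ratio_less: assumes "j < p" shows "s j / s (Suc j) < s (Suc j) / s (Suc (Suc j))"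
  using s_pos[OF assms] s_pos2[OF assms] s_det[of j] by (simp add: divide_simps)

lemma ratio_le: assumes "i \<le> j" "j \<le> p" shows "s i / s (Suc i) \<le> s j / s (Suc j)"
  using assms
proof (induction j)
  case (Suc j)
  then show ?case using ratio_less[of j] by (cases "i = Suc j") auto
qed simp

text \<open>Between consecutive ratios, the point \<open>al j 1 = be j 1\<close> separates the
  images of the two branches. Cross multiplied, each gap equals \<open>x\<close> or
  \<open>1 - x\<close> because the determinant is \<open>1\<close>.\<close>

lemma branch_bounds:
  assumes "j < p" "0 < x" "x < 1"
  shows "s j / s (Suc j) < al j x" "al j x < al j 1" "al j 1 < be j x" "be j x < s (Suc j) / s (Suc (Suc j))"
proof -
  define A B C where "A = s j" "B = s (Suc j)" "C = s (Suc (Suc j))"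
  note ABC = A_B_C_def
  have d: "B * B = 1 + A * C" using s_det by (simp add: ABC)
  have pos: "0 < B" "0 < C" "0 \<le> A" using s_facts[OF assms(1)] by (auto simp: ABC)
  have l: "0 < B * x + A" "0 < C * x + B" "0 < B + A * x" "0 < C + B * x"
    using lin_pos[OF assms(1,2)] by (auto simp: ABC)
  have "A * (C * x + B) < B * (B * x + A)" "(B * x + A) * (C + B) < (B + A) * (C * x + B)"
    "(B + A) * (C + B * x) < (B + A * x) * (C + B)" "(B + A * x) * C < B * (C + B * x)"
  proof -
    have "x * (A * C) < x * (B * B)" "(1 - x) * (A * C) < (1 - x) * (B * B)" using assms d by auto
    then show "A * (C * x + B) < B * (B * x + A)" "(B * x + A) * (C + B) < (B + A) * (C * x + B)"
    "(B + A) * (C + B * x) < (B + A * x) * (C + B)" "(B + A * x) * C < B * (C + B * x)"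
      by (simp_all add: algebra_simps)
  qed
  then show "s j / s (Suc j) < al j x" "al j x < al j 1" "al j 1 < be j x" "be j x < s (Suc j) / s (Suc (Suc j))"
    unfolding al_def be_def ABC[symmetric] using pos l
    by (auto intro!: frac_less_of_cross simp: add.commute mult.commute)
qed

lemma mob_letter_bounds:
  assumes "i \<in> ind" "0 < x" "x < 1"
  shows "s (fst i) / s (Suc (fst i)) < mob (letter i) x"
    "mob (letter i) x < s (Suc (fst i)) / s (Suc (Suc (fst i)))"
    "snd i \<longleftrightarrow> mob (letter i) x < al (fst i) 1"
proof -
  obtain j c where i: "i = (j, c)" "j < p" using assms(1) by (auto simp: ind_def)
  note b = branch_bounds[OF i(2) assms(2,3)]
  show "s (fst i) / s (Suc (fst i)) < mob (letter i) x"
    "mob (letter i) x < s (Suc (fst i)) / s (Suc (Suc (fst i)))"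
    "snd i \<longleftrightarrow> mob (letter i) x < al (fst i) 1"
    using b by (cases c; simp add: i mob_letter)+
qed

text \<open>The interval between consecutive ratios determines the index, the side of
  \<open>al j 1\<close> the kind of branch.\<close>

lemma mob_letter_disjoint:
  assumes "i \<in> ind" "k \<in> ind" "0 < x" "x < 1" "0 < y" "y < 1" "mob (letter i) x = mob (letter k) y"
  shows "i = k"
proof -
  have le: "fst i \<le> fst k"
    if "i \<in> ind" "k \<in> ind" "0 < x" "x < 1" "0 < y" "y < 1" "mob (letter i) x = mob (letter k) y" for i k x y
  proof (rule ccontr)
    assume "\<not> fst i \<le> fst k"
    then have "s (Suc (fst k)) / s (Suc (Suc (fst k))) \<le> s (fst i) / s (Suc (fst i))"
      using that by (intro ratio_le) (auto simp: ind_def)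
    then show False using mob_letter_bounds[of i x] mob_letter_bounds[of k y] that by auto
  qed
  have "fst i = fst k" using le[OF assms] le[of k i y x] assms by simp
  moreover from this have "snd i = snd k"
    using mob_letter_bounds(3)[of i x] mob_letter_bounds(3)[of k y] assms by simp
  ultimately show ?thesis by (simp add: prod_eq_iff)
qed

lemma mob_letter_01: assumes "i \<in> ind" "0 < x" shows "0 < mob (letter i) x" "mob (letter i) x < 1"
  using assms al_pos be_pos al_less_1 be_less_1 by (cases i; auto simp: ind_def mob_letter)+

definition words :: "nat \<Rightarrow> mat2 list set" where
  "words n = {ws. set ws \<subseteq> letter ` ind \<and> length ws = n}"

abbreviation word_prod :: "mat2 list \<Rightarrow> mat2" where
  "word_prod ws \<equiv> foldr (**) ws (mat 1)"

lemma nonneg_word: "set ws \<subseteq> letter ` ind \<Longrightarrow> nonneg_mat (word_prod ws)"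
  by (induction ws) (auto simp: nonneg_mat_1 intro!: nonneg_mat_mult nonneg_letter)

lemma mob_word_01: "set ws \<subseteq> letter ` ind \<Longrightarrow> 0 < x \<Longrightarrow> x < 1 \<Longrightarrow> 0 < mob (word_prod ws) x \<and> mob (word_prod ws) x < 1"
proof (induction ws)
  case (Cons A ws)
  then obtain i where i: "i \<in> ind" "A = letter i" by auto
  have "mob (word_prod (A # ws)) x = mob (letter i) (mob (word_prod ws) x)"
    using Cons.prems i nonneg_letter nonneg_word by (simp add: mob_mult)
  then show ?case using mob_letter_01 Cons i by auto
qed (simp add: mob_mat_1)

lemma inj_letter: "inj_on letter ind"
  using mob_letter_disjoint[of _ _ "1/2" "1/2"] by (intro inj_onI) auto

text \<open>Freeness, tested at one interior point: disjoint images recover the first letter, and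
  injectivity cancels it.\<close>

lemma word_eqI:
  assumes "length ws = length vs" "set ws \<subseteq> letter ` ind" "set vs \<subseteq> letter ` ind"
    and "mob (word_prod ws) (1/2) = mob (word_prod vs) (1/2)"
  shows "ws = vs"
  using assms
proof (induction ws vs rule: list_induct2)
  case (Cons A ws B vs)
  then obtain i k where ik: "i \<in> ind" "A = letter i" "k \<in> ind" "B = letter k" by auto
  have sub: "set ws \<subseteq> letter ` ind" "set vs \<subseteq> letter ` ind" using Cons.prems by auto
  have 1: "0 < mob (word_prod ws) (1/2)" "mob (word_prod ws) (1/2) < 1"
    "0 < mob (word_prod vs) (1/2)" "mob (word_prod vs) (1/2) < 1"
    using mob_word_01[OF sub(1), of "1/2"] mob_word_01[OF sub(2), of "1/2"] by auto
  have eq: "mob (letter i) (mob (word_prod ws) (1/2)) = mob (letter k) (mob (word_prod vs) (1/2))"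
    using Cons.prems(3) ik nonneg_letter nonneg_word[OF sub(1)] nonneg_word[OF sub(2)] by (simp add: mob_mult)
  then have "i = k" using mob_letter_disjoint[OF ik(1,3) 1] by blast
  moreover from this have "mob (word_prod ws) (1/2) = mob (word_prod vs) (1/2)"
    using mob_inj[OF nonneg_letter[OF ik(1)] 1(1,3)] eq by blast
  ultimately show ?case using Cons.IH[OF sub] ik by simp
qed simp

lemma words_Suc: "words (Suc n) = (\<lambda>(i, ws). letter i # ws) ` (ind \<times> words n)"
  unfolding words_def by (force simp: length_Suc_conv)

text \<open>The head of the list acts last, so summing over it turns \<open>u\<close> into
  \<open>Pop u\<close> at the image under the remaining word; hence the induction with arbitrary
  \<open>u\<close>.\<close>

lemma sum_words:
  assumes "0 < x" "x \<le> 1"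
  shows "(\<Sum>ws\<in>words n. weight (word_prod ws) x * u (mob (word_prod ws) x)) = (Pop ^^ n) u x"
proof (induction n arbitrary: u)
  case 0
  have "words 0 = {[]}" by (auto simp: words_def)
  moreover have "weight (mat 1) x = 1"
    using assms weight_mk2[of 1 0 0 1 x] by (simp add: mat_1_mk2)
  ultimately show ?case by (simp add: mob_mat_1)
next
  case (Suc n)
  have inj: "inj_on (\<lambda>(i, ws). letter i # ws) (ind \<times> words n)"
    using inj_letter by (auto simp: inj_on_def)
  have step: "weight (letter i ** word_prod ws) x * u (mob (letter i ** word_prod ws) x)
      = weight (word_prod ws) x * (weight (letter i) (mob (word_prod ws) x) * u (mob (letter i) (mob (word_prod ws) x)))"
    if "i \<in> ind" "ws \<in> words n" for i ws
    using that assms nonneg_letter nonneg_word by (simp add: words_def mob_mult)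
  have "(\<Sum>ws\<in>words (Suc n). weight (word_prod ws) x * u (mob (word_prod ws) x))
      = (\<Sum>(i, ws)\<in>ind \<times> words n. weight (word_prod ws) x *
          (weight (letter i) (mob (word_prod ws) x) * u (mob (letter i) (mob (word_prod ws) x))))"
    unfolding words_Suc sum.reindex[OF inj] by (intro sum.cong) (auto simp: step)
  also have "\<dots> = (\<Sum>ws\<in>words n. weight (word_prod ws) x *
          (\<Sum>i\<in>ind. weight (letter i) (mob (word_prod ws) x) * u (mob (letter i) (mob (word_prod ws) x))))"
    unfolding sum.cartesian_product[symmetric] sum_distrib_left by (rule sum.swap)
  also have "\<dots> = (\<Sum>ws\<in>words n. weight (word_prod ws) x * Pop u (mob (word_prod ws) x))"
    using assms mob_pos nonneg_word by (intro sum.cong refl) (simp add: sum_letters words_def)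
  also have "\<dots> = (Pop ^^ n) (Pop u) x" by (rule Suc.IH)
  finally show ?case by (simp only: Popn_Suc)
qed

text \<open>The sum runs over a set of maps; injectivity of the coding ensures that no two words are
  merged.\<close>

lemma sum_word_maps:
  assumes "0 < x" "x \<le> 1"
  shows "x * (\<Sum>h\<in>{mob (word_prod ws) |ws. ws \<in> words n}. \<bar>deriv h x\<bar> * f (h x)) = (Pop ^^ n) (\<lambda>y. y * f y) x"
proof -
  have "inj_on (\<lambda>ws. mob (word_prod ws)) (words n)"
    by (intro inj_onI word_eqI) (auto simp: words_def dest: fun_cong)
  moreover have "{mob (word_prod ws) |ws. ws \<in> words n} = (\<lambda>ws. mob (word_prod ws)) ` words n" by auto
  ultimately have "x * (\<Sum>h\<in>{mob (word_prod ws) |ws. ws \<in> words n}. \<bar>deriv h x\<bar> * f (h x))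
      = (\<Sum>ws\<in>words n. x * (\<bar>deriv (mob (word_prod ws)) x\<bar> * f (mob (word_prod ws) x)))"
    by (simp add: sum.reindex sum_distrib_left)
  also have "\<dots> = (\<Sum>ws\<in>words n. weight (word_prod ws) x * (mob (word_prod ws) x * f (mob (word_prod ws) x)))"
  proof (rule sum.cong)
    fix ws assume "ws \<in> words n"
    then have "0 < mob (word_prod ws) x" using mob_pos nonneg_word assms by (auto simp: words_def)
    then show "x * (\<bar>deriv (mob (word_prod ws)) x\<bar> * f (mob (word_prod ws) x))
        = weight (word_prod ws) x * (mob (word_prod ws) x * f (mob (word_prod ws) x))"
      by (simp add: weight_def)
  qed simp
  also have "\<dots> = (Pop ^^ n) (\<lambda>y. y * f y) x" by (rule sum_words[OF assms])
  finally show ?thesis .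
qed

end

section \<open>The sine sequence and the generators\<close>

lemma sin_pi_div_pos: "3 \<le> q \<Longrightarrow> 0 < sin (pi / real q)"
  by (intro sin_gt_zero) (auto simp: field_simps)

text \<open>The addition formulas give the recurrence, angles up to
  \<open>p * \<theta> < pi / 2\<close> give monotonicity, and \<open>p + (p + 1) = q\<close> gives
  the fold by reflection at \<open>pi / 2\<close>.\<close>

lemma hecke_seq_sq:
  assumes "3 \<le> q" "q = Suc (2 * p)"
  shows "hecke_seq (\<lambda>j. sq q (real j)) (hecke_lambda q) p"
proof
  define \<theta> where "\<theta> = pi / real q"
  have \<theta>: "0 < \<theta>" "0 < sin \<theta>" "q * \<theta> = pi" using assms(1) sin_pi_div_pos by (auto simp: \<theta>_def)
  have sq: "sq q y = sin (y * \<theta>) / sin \<theta>" for y by (simp add: sq_def \<theta>_def)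
  show "0 < p" using assms by simp
  show "sq q (real 0) = 0" by (simp add: sq)
  show "sq q (real (Suc 0)) = 1" using \<theta> by (simp add: sq)
  show "sq q (real (Suc (Suc j))) = hecke_lambda q * sq q (real (Suc j)) - sq q (real j)" for j
  proof -
    define a where "a = real (Suc j) * \<theta>"
    have "real (Suc (Suc j)) * \<theta> = a + \<theta>" "real j * \<theta> = a - \<theta>" by (simp_all add: a_def algebra_simps)
    then have eqs: "sq q (real (Suc (Suc j))) = sin (a + \<theta>) / sin \<theta>" "sq q (real j) = sin (a - \<theta>) / sin \<theta>"
      "sq q (real (Suc j)) = sin a / sin \<theta>" "hecke_lambda q = 2 * cos \<theta>"
      by (simp_all only: sq a_def) (simp add: hecke_lambda_def \<theta>_def)
    show ?thesis unfolding eqs using \<theta> by (simp add: sin_add sin_diff field_simps)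
  qed
  show "sq q (real j) < sq q (real (Suc j))" if "j < p" for j
  proof -
    have "2 * real (Suc j) \<le> real q" using that assms by simp
    then have "2 * real (Suc j) * \<theta> \<le> real q * \<theta>"
      by (rule mult_right_mono) (use \<theta> in simp)
    then have "real (Suc j) * \<theta> \<le> pi / 2" using \<theta> by (simp add: algebra_simps)
    moreover have "0 \<le> real j * \<theta>" using \<theta> by simp
    then have "- (pi / 2) \<le> real j * \<theta>" using pi_gt_zero by linarith
    moreover have "real j * \<theta> < real (Suc j) * \<theta>" using \<theta> by simp
    ultimately have "sin (real j * \<theta>) < sin (real (Suc j) * \<theta>)" by (intro sin_monotone_2pi)
    then show ?thesis using \<theta> unfolding sq by (intro divide_strict_right_mono)
  qed
  show "sq q (real (Suc p)) = sq q (real p)"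
  proof -
    have "real (Suc p) * \<theta> = pi - real p * \<theta>" using \<theta>(3) assms by (simp add: algebra_simps)
    then show ?thesis unfolding sq by (simp only: sin_pi_minus)
  qed
  show "hecke_lambda q \<le> 2" by (simp add: hecke_lambda_def)
qed

text \<open>With \<open>k = q - 1 - j\<close>, the reflection \<open>sin (pi - y) = sin y\<close>
  turns the entries of \<open>gmat q k\<close> into values of the sequence near \<open>j\<close>;
  inverting the matrices gives the letters.\<close>

lemma LambdaSet_eq:
  assumes "3 \<le> q" "q = Suc (2 * p)"
  shows "LambdaSet q = hecke_seq.letter (\<lambda>j. sq q (real j)) ` hecke_seq.ind p"
proof -
  interpret hecke_seq "\<lambda>j. sq q (real j)" "hecke_lambda q" p
    by (rule hecke_seq_sq[OF assms])
  define k where "k j = int q - 1 - int j" for j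
  have refl: "sq q (real_of_int (k j - i)) = sq q (real j + 1 + real_of_int i)" for i j
  proof -
    have "real_of_int (k j - i) * pi / real q = pi - (real j + 1 + real_of_int i) * pi / real q"
      using assms(1) by (simp add: k_def field_simps)
    then show ?thesis unfolding sq_def by (simp only: sin_pi_minus)
  qed
  have s: "sq q (real_of_int (k j)) = sq q (real (Suc j))" "sq q (real_of_int (k j + 1)) = sq q (real j)"
    "sq q (real_of_int (k j - 1)) = sq q (real (Suc (Suc j)))" for j
    using refl[of j 0] refl[of j "-1"] refl[of j 1] by (simp_all add: add.commute)
  have det: "sq q (real (Suc j)) * sq q (real (Suc j)) = 1 + sq q (real j) * sq q (real (Suc (Suc j)))" for j
    by (rule s_det)
  have g: "gmat q (k j) = mk2 (sq q (real (Suc j))) (- sq q (real j)) (- sq q (real (Suc (Suc j)))) (sq q (real (Suc j)))" for j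
    unfolding gmat_def s ..
  have alpha: "matrix_inv (gmat q (k j)) = letter (j, True)" for j
    unfolding g letter_def
    by (rule matrix_inv_eqI; simp add: mk2_mult mat_1_mk2 det mult.commute del: of_nat_Suc)
  have beta: "matrix_inv (Qmat ** gmat q (k j)) = letter (j, False)" for j
    unfolding g letter_def Qmat_def
    by (rule matrix_inv_eqI; simp add: mk2_mult mat_1_mk2 det mult.commute del: of_nat_Suc)
  have "Kset q = k ` {..<p}"
  proof -
    \<comment> \<open>The index \<open>j\<close> is \<open>q - 1 - i\<close> with
      \<open>q - 1 = 2 * p\<close>, so \<open>j < p\<close> corresponds to
      \<open>p + 1 \<le> i\<close>.\<close>
    have "i \<in> k ` {..<p}" if "int p + 1 \<le> i" "i \<le> 2 * int p" for i
      using that assms by (intro image_eqI[of _ _ "nat (2 * int p - i)"]) (auto simp: k_def)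
    moreover have "Kset q = {int p + 1..2 * int p}" using assms by (simp add: Kset_def)
    ultimately show ?thesis using assms by (auto simp: k_def)
  qed
  then have "LambdaSet q = (\<lambda>j. letter (j, True)) ` {..<p} \<union> (\<lambda>j. letter (j, False)) ` {..<p}"
    unfolding LambdaSet_def by (simp add: image_image alpha beta)
  also have "\<dots> = letter ` ind" unfolding ind_def UNIV_bool by auto
  finally show ?thesis .
qed

theorem theorem1p2:
  fixes q :: nat and x :: real and f :: "real \<Rightarrow> real"
  assumes "q \<ge> 3" and "odd q"
    and "0 < x" and "x \<le> 1"
    and "continuous_on {0..1} f"
  shows "(\<lambda>n. x * ln (real n) * (\<Sum>h\<in>Wset q n. \<bar>deriv h x\<bar> * f (h x)))
           \<longlonglongrightarrow> (LINT t:{0..1}|lborel. f t)"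
proof -
  obtain p where p: "q = Suc (2 * p)" using \<open>odd q\<close> by (auto elim!: oddE)
  interpret hecke_seq "\<lambda>j. sq q (real j)" "hecke_lambda q" p
    by (rule hecke_seq_sq[OF assms(1) p])
  interpret hecke_orbit "\<lambda>j. sq q (real j)" "hecke_lambda q" p x
    by unfold_locales (use assms in auto)
  have W: "Wset q n = {mob (word_prod ws) |ws. ws \<in> words n}" for n
    unfolding Wset_def words_def LambdaSet_eq[OF assms(1) p] by auto
  have "(\<lambda>n. x * ln (real n) * (\<Sum>h\<in>Wset q n. \<bar>deriv h x\<bar> * f (h x))) = V (\<lambda>y. y * f y)"
    unfolding W V_def[abs_def] sum_word_maps[OF assms(3,4), symmetric] by (simp add: mult_ac)
  moreover have "(LINT t:{0..1}|lborel. f t) = integral {0..1} f"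
    by (intro set_borel_integral_eq_integral borel_integrable_atLeastAtMost' assms(5))
  ultimately show ?thesis using equidistribution[OF assms(5)] by simp
qed

end
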